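(* Let $A=\sigma(R)\langle x_1,\dots,x_n\rangle$ be a bijective skew PBW extension of an LGS ring $R$, with $\mathrm{Mon}(A)$ endowed with a monomial order. Let $F=\{f_1,\dots,f_s\}$ be a set of non-zero elements of $A$. Then the following algorithm (Buchberger's algorithm for bijective skew PBW extensions) produces a Gröbner basis $G$ for the left ideal of $A$ generated by $F$ (here $P(X)$ is the set of subsets of $X$): Initialize $G:=\emptyset$, $G':=F$. While $G'\neq G$ do: put $D:=P(G')-P(G)$ and then $G:=G'$; for each $S=\{g_{i_1},\dots,g_{i_k}\}\in D$, compute $B_S$, and for each $(b_1,\dots,b_k)\in B_S$ reduce $\sum_{j=1}^k b_jx^{\gamma_j}g_{i_j}\xrightarrow{\,G'\,}_+ r$ with $r$ reduced with respect to $G'$, and if $r\neq0$ put $G':=G'\cup\{r\}$. Output $G$.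
   Context: Rings are associative with unit; $\mathbb N$ contains $0$. Skew PBW extensions. Let $R\subseteq A$ be rings. $A$ is a skew PBW extension of $R$, written $A=\sigma(R)\langle x_1,\dots,x_n\rangle$, if: (1) there are $x_1,\dots,x_n\in A$ such that $A$ is a free left $R$-module with basis $\mathrm{Mon}(A)=\{x^\alpha=x_1^{\alpha_1}\cdots x_n^{\alpha_n}\mid \alpha\in\mathbb N^n\}$; (2) for every $i$ and $r\in R\setminus\{0\}$ there is $c_{i,r}\in R\setminus\{0\}$ with $x_ir-c_{i,r}x_i\in R$; (3) for all $1\le i,j\le n$ there is $c_{i,j}\in R\setminus\{0\}$ with $x_jx_i-c_{i,j}x_ix_j\in R+Rx_1+\cdots+Rx_n$. Then for each $i$ there are an injective ring endomorphism $\sigma_i$ of $R$ and a $\sigma_i$-derivation $\delta_i$ of $R$ with $x_ir=\sigma_i(r)x_i+\delta_i(r)$ for all $r\in R$. $A$ is bijective if every $\sigma_i$ is bijective and $c_{i,j}$ is invertible for all $1\le i<j\le n$. Put $\sigma^\alpha:=\sigma_1^{\alpha_1}\cdots\sigma_n^{\alpha_n}$, $|\alpha|:=\alpha_1+\cdots+\alpha_n$, $\exp(x^\alpha):=\alpha$, $\deg(x^\alpha):=|\alpha|$, and for non-zero $f\in A$ let $\deg(f)$ be the maximal degree of its monomials. For $\alpha,\beta\in\mathbb N^n$ there are unique $c_{\alpha,\beta}\in R$, $p_{\alpha,\beta}\in A$ with $x^\alpha x^\beta=c_{\alpha,\beta}x^{\alpha+\beta}+p_{\alpha,\beta}$, where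 $p_{\alpha,\beta}=0$ or $\deg(p_{\alpha,\beta})<|\alpha+\beta|$. LGS rings. $R$ is left Gröbner soluble (LGS) if $R$ is left Noetherian; there is an algorithm deciding, for $a,r_1,\dots,r_m\in R$, whether $a\in Rr_1+\cdots+Rr_m$ and, if so, finding $b_i$ with $a=\sum b_ir_i$; and there is an algorithm computing a finite generating set of the left $R$-module $\mathrm{Syz}_R[r_1\ \cdots\ r_m]:=\{(b_1,\dots,b_m)\in R^m\mid b_1r_1+\cdots+b_mr_m=0\}$. Monomial orders. For a total order $\succeq$ on $\mathrm{Mon}(A)$ and $0\neq f=c_1X_1+\cdots+c_tX_t$ with $c_i\in R\setminus\{0\}$ and $X_1\succ\cdots\succ X_t$ in $\mathrm{Mon}(A)$, put $lm(f):=X_1$, $lc(f):=c_1$; also $lm(0)=0$, $lc(0)=0$ and $X\succ 0$ for all monomials $X$. $\succeq$ is a monomial order if: $x^\beta\succeq x^\alpha$ implies $lm(x^\gamma x^\beta x^\lambda)\succeq lm(x^\gamma x^\alpha x^\lambda)$ for all $\gamma,\lambda$; $x^\alpha\succeq 1$ for all $\alpha$; and $|\beta|>|\alpha|$ implies $x^\beta\succeq x^\alpha$. $x^\alpha$ divides $x^\beta$ iff $\beta-\alpha\in\mathbb N^n$; the least common multiple of monomials is given by componentwise maxima of exponents. Reduction. Let $F$ be a finite set of non-zero elements of $A$. $f\xrightarrow{F}h$ (one step) means there are $f_1,\dots,f_t\in F$, $r_1,\dots,r_t\in R$ and $\alpha_i\in\mathbb N^n$ with $\alpha_i+\exp(lm(f_i))=\exp(lm(f))$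 for all $i$, $lc(f)=\sum_{i} r_i\sigma^{\alpha_i}(lc(f_i))c_{\alpha_i,\exp(lm(f_i))}$, and $h=f-\sum_i r_ix^{\alpha_i}f_i$; by convention $0\xrightarrow{F}0$. $f\xrightarrow{F}_+h$ means $h$ is obtained from $f$ by finitely many one-step reductions. A non-zero $f$ is reducible w.r.t. $F$ if a one-step reduction of $f$ by $F$ exists; otherwise (or if $f=0$) it is reduced. Gröbner bases. For a left ideal $I\neq0$ of $A$, a non-empty finite set $G$ of non-zero elements of $I$ is a Gröbner basis for $I$ if every $0\neq f\in I$ is reducible w.r.t. $G$. $\{0\}$ is a Gröbner basis of the zero ideal. The sets $B_S$. For $S=\{g_{i_1},\dots,g_{i_k}\}\subseteq A\setminus\{0\}$, let $X_S$ be the least common multiple of $lm(g_{i_1}),\dots,lm(g_{i_k})$, $\beta_j:=\exp(lm(g_{i_j}))$, and $\gamma_j\in\mathbb N^n$ with $\gamma_j+\beta_j=\exp(X_S)$. $B_S$ denotes a finite generating set of the left $R$-module $\mathrm{Syz}_R[\sigma^{\gamma_1}(lc(g_{i_1}))c_{\gamma_1,\beta_1}\ \cdots\ \sigma^{\gamma_k}(lc(g_{i_k}))c_{\gamma_k,\beta_k}]$. *)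

theory Defs
  imports HOL.Hull "HOL-Library.Function_Algebras"
begin

text \<open>
  The big ring \<open>A\<close> is the type \<open>'a :: ring_1\<close>, the coefficient ring \<open>R\<close> is a subset of it, and the
  variables are \<open>x 0, \<dots>, x (n - 1)\<close>. Exponent vectors of length \<open>n\<close> are functions
  \<open>nat \<Rightarrow> nat\<close> that vanish from \<open>n\<close> on, with the pointwise \<open>+\<close>, \<open>-\<close> and \<open>\<le>\<close>; in particular
  \<open>\<alpha> \<le> \<beta>\<close> is divisibility of monomials, and \<open>\<beta> - \<alpha>\<close> is only used when it holds.
\<close>

section \<open>Subrings, left ideals and linear equations over a subring\<close>

definition unital_subring :: "'a::ring_1 set \<Rightarrow> bool" where
  "unital_subring R \<longleftrightarrow> 1 \<in> R \<and> (\<forall>a\<in>R. \<forall>b\<in>R. a - b \<in> R \<and> a * b \<in> R)"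

definition left_ideal :: "'a::ring_1 set \<Rightarrow> 'a set \<Rightarrow> bool" where
  "left_ideal R I \<longleftrightarrow> I \<subseteq> R \<and> 0 \<in> I \<and> (\<forall>a\<in>I. \<forall>b\<in>I. a + b \<in> I) \<and> (\<forall>r\<in>R. \<forall>a\<in>I. r * a \<in> I)"

definition left_noetherian :: "'a::ring_1 set \<Rightarrow> bool" where
  "left_noetherian R \<longleftrightarrow> (\<forall>I. left_ideal R I \<longrightarrow> (\<exists>X. finite X \<and> X \<subseteq> R \<and> I = left_ideal R hull X))"

definition left_solution :: "'a::ring_1 set \<Rightarrow> 'a \<Rightarrow> 'a list \<Rightarrow> 'a list \<Rightarrow> bool" where
  "left_solution R a rs bs \<longleftrightarrow>
     length bs = length rs \<and> set bs \<subseteq> R \<and> a = (\<Sum>(b, r)\<leftarrow>zip bs rs. b * r)"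

definition Syz :: "'a::ring_1 set \<Rightarrow> 'a list \<Rightarrow> 'a list set" where
  "Syz R rs = {bs. left_solution R 0 rs bs}"

definition generates_Syz :: "'a::ring_1 set \<Rightarrow> 'a list \<Rightarrow> 'a list set \<Rightarrow> bool" where
  "generates_Syz R rs B \<longleftrightarrow> finite B \<and> B \<subseteq> Syz R rs \<and>
     (\<forall>s\<in>Syz R rs. \<exists>q. (\<forall>b\<in>B. q b \<in> R) \<and> s = map (\<lambda>j. \<Sum>b\<in>B. q b * b ! j) [0..<length rs])"

text \<open>
  The two algorithms that belong to a left Groebner soluble ring are given as data: \<open>solve a rs\<close>
  decides whether \<open>a\<close> lies in the left ideal generated by \<open>rs\<close> and returns coefficients if so;
  \<open>syz rs\<close> is a finite generating set of the syzygy module. They serve as subroutines below.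
\<close>

definition lgs_ring ::
  "'a::ring_1 set \<Rightarrow> ('a \<Rightarrow> 'a list \<Rightarrow> 'a list option) \<Rightarrow> ('a list \<Rightarrow> 'a list set) \<Rightarrow> bool" where
  "lgs_ring R solve syz \<longleftrightarrow> left_noetherian R \<and>
     (\<forall>a\<in>R. \<forall>rs\<in>lists R.
        (case solve a rs of
           None \<Rightarrow> \<not> (\<exists>bs. left_solution R a rs bs)
         | Some bs \<Rightarrow> left_solution R a rs bs)) \<and>
     (\<forall>rs\<in>lists R. generates_Syz R rs (syz rs))"

section \<open>Skew PBW extensions\<close>

definition exponents :: "nat \<Rightarrow> (nat \<Rightarrow> nat) set" where
  "exponents n = {\<alpha>. \<forall>i\<ge>n. \<alpha> i = 0}"

definition total_degree :: "nat \<Rightarrow> (nat \<Rightarrow> nat) \<Rightarrow> nat" where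
  "total_degree n \<alpha> = (\<Sum>i<n. \<alpha> i)"

definition monomial :: "nat \<Rightarrow> (nat \<Rightarrow> 'a::ring_1) \<Rightarrow> (nat \<Rightarrow> nat) \<Rightarrow> 'a" where
  "monomial n x \<alpha> = prod_list (map (\<lambda>i. x i ^ \<alpha> i) [0..<n])"

definition coordinates ::
  "'a::ring_1 set \<Rightarrow> 'i set \<Rightarrow> ('i \<Rightarrow> 'a) \<Rightarrow> 'a \<Rightarrow> ('i \<Rightarrow> 'a) \<Rightarrow> bool" where
  "coordinates R I b f c \<longleftrightarrow>
     range c \<subseteq> R \<and> finite {\<alpha>. c \<alpha> \<noteq> 0} \<and> {\<alpha>. c \<alpha> \<noteq> 0} \<subseteq> I \<and> f = (\<Sum>\<alpha> | c \<alpha> \<noteq> 0. c \<alpha> * b \<alpha>)"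

definition left_basis :: "'a::ring_1 set \<Rightarrow> 'i set \<Rightarrow> ('i \<Rightarrow> 'a) \<Rightarrow> bool" where
  "left_basis R I b \<longleftrightarrow> (\<forall>f. \<exists>!c. coordinates R I b f c)"

definition affine_part :: "'a::ring_1 set \<Rightarrow> nat \<Rightarrow> (nat \<Rightarrow> 'a) \<Rightarrow> 'a set" where
  "affine_part R n x = {r + (\<Sum>k<n. s k * x k) | r s. r \<in> R \<and> (\<forall>k<n. s k \<in> R)}"

locale skew_pbw =
  fixes R :: "'a::ring_1 set" and n :: nat and x :: "nat \<Rightarrow> 'a"
  assumes subring: "unital_subring R"
    and basis: "left_basis R (exponents n) (monomial n x)"
    and commute_coeff: "\<And>i r. i < n \<Longrightarrow> r \<in> R - {0} \<Longrightarrow> \<exists>c\<in>R - {0}. x i * r - c * x i \<in> R"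
    and commute_var: "\<And>i j. i < n \<Longrightarrow> j < n \<Longrightarrow>
      \<exists>c\<in>R - {0}. x j * x i - c * x i * x j \<in> affine_part R n x"
begin

definition sigma :: "nat \<Rightarrow> 'a \<Rightarrow> 'a" where
  "sigma i r = (THE s. s \<in> R \<and> x i * r - s * x i \<in> R)"

text \<open>Only meaningful for \<open>i < j\<close>, where the basis property makes \<open>c\<close> unique.\<close>

definition c_var :: "nat \<Rightarrow> nat \<Rightarrow> 'a" where
  "c_var i j = (THE c. c \<in> R \<and> x j * x i - c * x i * x j \<in> affine_part R n x)"

definition sigma_pow :: "(nat \<Rightarrow> nat) \<Rightarrow> 'a \<Rightarrow> 'a" where
  "sigma_pow \<alpha> = foldr (\<lambda>i h. (sigma i ^^ \<alpha> i) \<circ> h) [0..<n] id"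

definition coefficient :: "'a \<Rightarrow> (nat \<Rightarrow> nat) \<Rightarrow> 'a" where
  "coefficient f = (THE c. coordinates R (exponents n) (monomial n x) f c)"

definition support :: "'a \<Rightarrow> (nat \<Rightarrow> nat) set" where
  "support f = {\<alpha>. coefficient f \<alpha> \<noteq> 0}"

definition deg :: "'a \<Rightarrow> nat" where
  "deg f = Max (total_degree n ` support f)"

definition c_mon :: "(nat \<Rightarrow> nat) \<Rightarrow> (nat \<Rightarrow> nat) \<Rightarrow> 'a" where
  "c_mon \<alpha> \<beta> = (THE c. c \<in> R \<and>
     (let p = monomial n x \<alpha> * monomial n x \<beta> - c * monomial n x (\<alpha> + \<beta>)
      in p = 0 \<or> deg p < total_degree n (\<alpha> + \<beta>)))"

text \<open>
  A total order on the monomials is a linear order \<open>ord\<close> on their exponents;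
  \<open>(\<alpha>, \<beta>) \<in> ord\<close> means that the monomial of \<open>\<beta>\<close> is the larger one. For \<open>f \<noteq> 0\<close>, \<open>lexp ord f\<close> is
  the exponent of the leading monomial. All coefficients of \<open>0\<close> vanish, hence \<open>lc ord 0 = 0\<close>.
\<close>

definition lexp :: "(nat \<Rightarrow> nat) rel \<Rightarrow> 'a \<Rightarrow> (nat \<Rightarrow> nat)" where
  "lexp ord f = (THE \<alpha>. \<alpha> \<in> support f \<and> (\<forall>\<beta>\<in>support f. (\<beta>, \<alpha>) \<in> ord))"

definition lc :: "(nat \<Rightarrow> nat) rel \<Rightarrow> 'a \<Rightarrow> 'a" where
  "lc ord f = coefficient f (lexp ord f)"

text \<open>The order on leading monomials, where the leading monomial \<open>0\<close> of \<open>0\<close> is the least.\<close>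

definition lm_le :: "(nat \<Rightarrow> nat) rel \<Rightarrow> 'a \<Rightarrow> 'a \<Rightarrow> bool" where
  "lm_le ord f g \<longleftrightarrow> f = 0 \<or> (g \<noteq> 0 \<and> (lexp ord f, lexp ord g) \<in> ord)"

definition monomial_order :: "(nat \<Rightarrow> nat) rel \<Rightarrow> bool" where
  "monomial_order ord \<longleftrightarrow> linear_order_on (exponents n) ord \<and>
     (\<forall>\<alpha>\<in>exponents n. \<forall>\<beta>\<in>exponents n. (\<alpha>, \<beta>) \<in> ord \<longrightarrow>
        (\<forall>\<gamma>\<in>exponents n. \<forall>\<mu>\<in>exponents n.
           lm_le ord (monomial n x \<gamma> * monomial n x \<alpha> * monomial n x \<mu>)
                     (monomial n x \<gamma> * monomial n x \<beta> * monomial n x \<mu>))) \<and>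
     (\<forall>\<alpha>\<in>exponents n. (0, \<alpha>) \<in> ord) \<and>
     (\<forall>\<alpha>\<in>exponents n. \<forall>\<beta>\<in>exponents n. total_degree n \<alpha> < total_degree n \<beta> \<longrightarrow> (\<alpha>, \<beta>) \<in> ord)"

section \<open>Reduction and Groebner bases\<close>

text \<open>
  If \<open>lexp ord g \<le> \<delta>\<close>, then \<open>cofactor ord \<delta> g\<close> is the \<open>\<gamma>\<close> with \<open>\<gamma> + lexp ord g = \<delta>\<close>, and
  \<open>shifted_lc ord \<delta> g\<close> is the element \<open>\<sigma>\<^sup>\<gamma> (lc g) c\<^bsub>\<gamma>,exp (lm g)\<^esub>\<close>.
\<close>

definition cofactor :: "(nat \<Rightarrow> nat) rel \<Rightarrow> (nat \<Rightarrow> nat) \<Rightarrow> 'a \<Rightarrow> (nat \<Rightarrow> nat)" where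
  "cofactor ord \<delta> g = \<delta> - lexp ord g"

definition shifted_lc :: "(nat \<Rightarrow> nat) rel \<Rightarrow> (nat \<Rightarrow> nat) \<Rightarrow> 'a \<Rightarrow> 'a" where
  "shifted_lc ord \<delta> g =
     sigma_pow (cofactor ord \<delta> g) (lc ord g) * c_mon (cofactor ord \<delta> g) (lexp ord g)"

definition shifted_sum :: "(nat \<Rightarrow> nat) rel \<Rightarrow> (nat \<Rightarrow> nat) \<Rightarrow> 'a list \<Rightarrow> 'a list \<Rightarrow> 'a" where
  "shifted_sum ord \<delta> bs gs = (\<Sum>(b, g)\<leftarrow>zip bs gs. b * monomial n x (cofactor ord \<delta> g) * g)"

text \<open>
  One-step reduction of \<open>f\<close> to \<open>h\<close> by \<open>F\<close>. The parameter \<open>sol a cs\<close> says which coefficient lists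
  \<open>rs\<close> may be used to write \<open>a\<close> as \<open>\<Sum> r\<^sub>i c\<^sub>i\<close>. With \<open>sol = left_solution R\<close> every such list is
  admitted, which is the unrestricted notion of reduction.
\<close>

definition reduces ::
  "(nat \<Rightarrow> nat) rel \<Rightarrow> ('a \<Rightarrow> 'a list \<Rightarrow> 'a list \<Rightarrow> bool) \<Rightarrow> 'a set \<Rightarrow> 'a \<Rightarrow> 'a \<Rightarrow> bool" where
  "reduces ord sol F f h \<longleftrightarrow> (f = 0 \<and> h = 0) \<or>
     (f \<noteq> 0 \<and> (\<exists>fs rs. set fs \<subseteq> F \<and> (\<forall>g\<in>set fs. lexp ord g \<le> lexp ord f) \<and>
        sol (lc ord f) (map (shifted_lc ord (lexp ord f)) fs) rs \<and>
        h = f - shifted_sum ord (lexp ord f) rs fs))"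

definition reducible ::
  "(nat \<Rightarrow> nat) rel \<Rightarrow> ('a \<Rightarrow> 'a list \<Rightarrow> 'a list \<Rightarrow> bool) \<Rightarrow> 'a set \<Rightarrow> 'a \<Rightarrow> bool" where
  "reducible ord sol F f \<longleftrightarrow> f \<noteq> 0 \<and> (\<exists>h. reduces ord sol F f h)"

definition groebner_basis :: "(nat \<Rightarrow> nat) rel \<Rightarrow> 'a set \<Rightarrow> 'a set \<Rightarrow> bool" where
  "groebner_basis ord I G \<longleftrightarrow>
     (if I = {0} then G = {0}
      else finite G \<and> G \<noteq> {} \<and> G \<subseteq> I - {0} \<and>
           (\<forall>f\<in>I - {0}. reducible ord (left_solution R) G f))"

end

text \<open>The coefficients \<open>c_var i j\<close> must be units of \<open>R\<close>, not just of the big ring.\<close>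

locale bijective_skew_pbw = skew_pbw +
  assumes sigma_bij: "\<And>i. i < n \<Longrightarrow> bij_betw (sigma i) R R"
    and c_var_unit: "\<And>i j. i < j \<Longrightarrow> j < n \<Longrightarrow> \<exists>d\<in>R. c_var i j * d = 1 \<and> d * c_var i j = 1"

section \<open>Buchberger's algorithm\<close>

text \<open>
  The states are the control points of the program, with the current values of its variables:
  \<^item> \<open>Test G G'\<close>: about to evaluate the loop condition \<open>G' \<noteq> G\<close>;
  \<^item> \<open>For_S G G' D\<close>: the sets in \<open>D\<close> are still to be processed;
  \<^item> \<open>For_B G G' D gs B\<close>: in the current \<open>S = set gs\<close>, the syzygies in \<open>B\<close> are still to be processed;
  \<^item> \<open>Reduce G G' D gs B f\<close>: a combination is being reduced by \<open>G'\<close>, and has become \<open>f\<close>;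
  \<^item> \<open>Output G\<close>: the program has stopped.
\<close>

datatype 'a state =
    Test "'a set" "'a set"
  | For_S "'a set" "'a set" "'a set set"
  | For_B "'a set" "'a set" "'a set set" "'a list" "'a list set"
  | Reduce "'a set" "'a set" "'a set set" "'a list" "'a list set" 'a
  | Output "'a set"

context skew_pbw
begin

definition lcm_exp :: "(nat \<Rightarrow> nat) rel \<Rightarrow> 'a set \<Rightarrow> (nat \<Rightarrow> nat)" where
  "lcm_exp ord S = (\<lambda>i. Max ((\<lambda>g. lexp ord g i) ` S))"

text \<open>
  The order in which the loops run through \<open>D\<close> and \<open>B\<close>, the enumeration of \<open>S\<close> and the elements
  used in a reduction step are left open. The admissible reduction coefficients are given by \<open>sol\<close>,
  the admissible choices of \<open>B\<^sub>S\<close> by \<open>gens\<close>. Reduction stops as soon as \<open>f\<close> is reduced (possibly \<open>0\<close>).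
\<close>

inductive buchberger_step ::
  "(nat \<Rightarrow> nat) rel \<Rightarrow> ('a \<Rightarrow> 'a list \<Rightarrow> 'a list \<Rightarrow> bool) \<Rightarrow> ('a list \<Rightarrow> 'a list set \<Rightarrow> bool) \<Rightarrow>
   'a state \<Rightarrow> 'a state \<Rightarrow> bool"
  for ord sol gens where
  enter: "G' \<noteq> G \<Longrightarrow>
    buchberger_step ord sol gens (Test G G') (For_S G' G' (Pow G' - Pow G))"
| stop: "G' = G \<Longrightarrow>
    buchberger_step ord sol gens (Test G G') (Output G)"
| next_S: "S \<in> D \<Longrightarrow> set gs = S \<Longrightarrow> distinct gs \<Longrightarrow>
    gens (map (shifted_lc ord (lcm_exp ord S)) gs) B \<Longrightarrow>
    buchberger_step ord sol gens (For_S G G' D) (For_B G G' (D - {S}) gs B)"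
| done_S: "buchberger_step ord sol gens (For_S G G' {}) (Test G G')"
| next_b: "b \<in> B \<Longrightarrow>
    buchberger_step ord sol gens (For_B G G' D gs B)
      (Reduce G G' D gs (B - {b}) (shifted_sum ord (lcm_exp ord (set gs)) b gs))"
| done_b: "buchberger_step ord sol gens (For_B G G' D gs {}) (For_S G G' D)"
| reduce: "f \<noteq> 0 \<Longrightarrow> reduces ord sol G' f h \<Longrightarrow>
    buchberger_step ord sol gens (Reduce G G' D gs B f) (Reduce G G' D gs B h)"
| reduced_nonzero: "f \<noteq> 0 \<Longrightarrow> \<not> reducible ord sol G' f \<Longrightarrow>
    buchberger_step ord sol gens (Reduce G G' D gs B f) (For_B G (insert f G') D gs B)"
| reduced_zero:
    "buchberger_step ord sol gens (Reduce G G' D gs B 0) (For_B G G' D gs B)"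

end

text \<open>Every run from \<open>s\<close> is finite, and a run that cannot be continued has output a \<open>G\<close> with \<open>P G\<close>.\<close>

definition always_produces ::
  "('a state \<Rightarrow> 'a state \<Rightarrow> bool) \<Rightarrow> 'a state \<Rightarrow> ('a set \<Rightarrow> bool) \<Rightarrow> bool" where
  "always_produces step s P \<longleftrightarrow>
     \<not> (\<exists>run. run 0 = s \<and> (\<forall>k::nat. step (run k) (run (Suc k)))) \<and>
     (\<forall>t. step\<^sup>*\<^sup>* s t \<longrightarrow> \<not> (\<exists>u. step t u) \<longrightarrow> (\<exists>G. t = Output G \<and> P G))"

end

theory Submission
  imports Defs Complex_Main
begin

text \<open>
  Modulo terms of lower degree, a skew PBW extension behaves like a polynomial ring: a scalar \<open>r\<close>
  passes a monomial and becomes \<open>sigma_pow \<alpha> r\<close>, and monomials multiply by adding exponents, up to a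
  coefficient that is a unit of \<open>R\<close> in the bijective case (\<open>monomial_times_scalar\<close>, \<open>c_mon_rule\<close>). A
  monomial order refines the degree, so the lower terms never interfere with leading terms: leading
  exponents add, and the leading coefficients follow the rule \<open>monomial_times_below_eq\<close>.

  Correctness is Buchberger's criterion in its form for coefficient rings, where all subsets \<open>S\<close> of
  \<open>G\<close> take the place of the pairs. Write an element of the ideal as a left combination of \<open>G\<close> and let
  \<open>\<delta>\<close> be the largest leading exponent of its terms. If the terms at \<open>\<delta>\<close> do not cancel, they exhibit
  the leading coefficient as a combination of shifted leading coefficients, so the element is
  reducible. If they cancel, their coefficients form a syzygy of the generators whose leading
  monomials divide \<open>\<delta>\<close>. This syzygy is a translate of one at the least common multiple
  (\<open>shifted_lc_shift\<close>), hence a combination of the generating syzygies \<open>B\<^sub>S\<close>, and if the combinations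
  that belong to \<open>B\<^sub>S\<close> have representations strictly below the least common multiple, then the terms
  at \<open>\<delta>\<close> can be traded for smaller ones (\<open>lower_representation\<close>). Below any exponent there are only
  finitely many, so this descent ends. The algorithm supplies these representations: a reduction
  subtracts terms that do not exceed the current leading exponent, and its nonzero remainder joins the
  generators. The loop invariant records just this.

  Termination of a single reduction is again the finiteness below an exponent, and the two inner
  loops run through finite sets. A pass of the outer loop is followed by another one only if it has
  found an element that is irreducible with respect to those already present. There is no infinite
  sequence of such elements \<open>r\<^sub>k\<close> (\<open>no_irreducible_sequence\<close>): by Dickson's lemma one may assume that
  the leading monomial of each divides that of the next. Moving the leading coefficient to the right
  of the monomial, \<open>r\<^sub>k = mon \<beta>\<^sub>k * d\<^sub>k + \<dots>\<close>, turns irreducibility into the statement that \<open>d\<^sub>k\<close> is not in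
  the left ideal generated by the earlier \<open>d\<^sub>i\<close> (\<open>shifted_lc_normalised\<close>), which is impossible for all
  \<open>k\<close> in a left Noetherian ring.
\<close>


section \<open>Coefficients with respect to the monomial basis\<close>

context skew_pbw
begin

abbreviation mon :: "(nat \<Rightarrow> nat) \<Rightarrow> 'a" where
  "mon \<equiv> monomial n x"

lemma one_in_R: "1 \<in> R" and diff_in_R: "a \<in> R \<Longrightarrow> b \<in> R \<Longrightarrow> a - b \<in> R"
  and mult_in_R: "a \<in> R \<Longrightarrow> b \<in> R \<Longrightarrow> a * b \<in> R"
  using subring by (auto simp: unital_subring_def)

lemma zero_in_R: "0 \<in> R"
  using diff_in_R[OF one_in_R one_in_R] by simp

lemma uminus_in_R: "a \<in> R \<Longrightarrow> - a \<in> R"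
  using diff_in_R[OF zero_in_R] by simp

lemma add_in_R: "a \<in> R \<Longrightarrow> b \<in> R \<Longrightarrow> a + b \<in> R"
  using diff_in_R[of a "- b"] uminus_in_R[of b] by simp

lemma sum_in_R: "(\<And>i. i \<in> I \<Longrightarrow> f i \<in> R) \<Longrightarrow> sum f I \<in> R"
  by (induction I rule: infinite_finite_induct) (auto intro: add_in_R zero_in_R)

lemmas R_closed = one_in_R zero_in_R diff_in_R add_in_R uminus_in_R mult_in_R sum_in_R

lemma coordinates_coefficient: "coordinates R (exponents n) mon f (coefficient f)"
  using basis unfolding left_basis_def coefficient_def by (metis (mono_tags, lifting) theI')

lemma coefficient_in_R: "coefficient f \<alpha> \<in> R"
  using coordinates_coefficient[of f] by (auto simp: coordinates_def)

lemma finite_support: "finite (support f)" and support_subset: "support f \<subseteq> exponents n"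
  and expansion: "f = (\<Sum>\<alpha>\<in>support f. coefficient f \<alpha> * mon \<alpha>)"
  using coordinates_coefficient[of f] by (auto simp: coordinates_def support_def)

lemma coefficient_eqI:
  assumes T: "finite T" "T \<subseteq> exponents n" and c: "\<And>\<alpha>. c \<alpha> \<in> R" "\<And>\<alpha>. \<alpha> \<notin> T \<Longrightarrow> c \<alpha> = 0"
    and f: "f = (\<Sum>\<alpha>\<in>T. c \<alpha> * mon \<alpha>)"
  shows "coefficient f = c"
proof -
  have sub: "{\<alpha>. c \<alpha> \<noteq> 0} \<subseteq> T" using c(2) by auto
  have "f = (\<Sum>\<alpha> | c \<alpha> \<noteq> 0. c \<alpha> * mon \<alpha>)"
    unfolding f by (rule sum.mono_neutral_right) (use T sub in auto)
  then have "coordinates R (exponents n) mon f c"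
    using sub T c(1) finite_subset[OF sub] by (auto simp: coordinates_def)
  then show ?thesis
    using basis coordinates_coefficient[of f] unfolding left_basis_def by metis
qed

lemma expansion_on:
  assumes "finite T" "support f \<subseteq> T"
  shows "f = (\<Sum>\<alpha>\<in>T. coefficient f \<alpha> * mon \<alpha>)"
  by (subst expansion[of f], rule sum.mono_neutral_left) (use assms in \<open>auto simp: support_def\<close>)

lemma coefficient_outside: "\<alpha> \<notin> support f \<Longrightarrow> coefficient f \<alpha> = 0"
  by (simp add: support_def)

lemma coefficient_add: "coefficient (f + g) \<alpha> = coefficient f \<alpha> + coefficient g \<alpha>"
proof -
  let ?T = "support f \<union> support g"
  have "f + g = (\<Sum>\<alpha>\<in>?T. coefficient f \<alpha> * mon \<alpha>) + (\<Sum>\<alpha>\<in>?T. coefficient g \<alpha> * mon \<alpha>)"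
    using expansion_on[of ?T f] expansion_on[of ?T g] finite_support by simp
  then have "coefficient (f + g) = (\<lambda>\<alpha>. coefficient f \<alpha> + coefficient g \<alpha>)"
    using finite_support support_subset
    by (intro coefficient_eqI[of ?T])
       (auto simp: sum.distrib distrib_right coefficient_outside intro: R_closed coefficient_in_R)
  then show ?thesis by simp
qed

lemma coefficient_mult:
  assumes "r \<in> R"
  shows "coefficient (r * f) \<alpha> = r * coefficient f \<alpha>"
proof -
  have "r * f = (\<Sum>\<alpha>\<in>support f. r * coefficient f \<alpha> * mon \<alpha>)"
    by (subst expansion[of f]) (simp add: sum_distrib_left mult.assoc)
  then have "coefficient (r * f) = (\<lambda>\<alpha>. r * coefficient f \<alpha>)"
    using finite_support support_subset assms
    by (intro coefficient_eqI[of "support f"])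
       (auto simp: coefficient_outside intro: R_closed coefficient_in_R)
  then show ?thesis by simp
qed

lemma coefficient_zero [simp]: "coefficient 0 \<alpha> = 0"
  using coefficient_mult[OF zero_in_R, of 0 \<alpha>] by simp

lemma coefficient_uminus: "coefficient (- f) \<alpha> = - coefficient f \<alpha>"
  using coefficient_add[of f "- f" \<alpha>] by (simp add: eq_neg_iff_add_eq_0 add.commute)

lemma coefficient_diff: "coefficient (f - g) \<alpha> = coefficient f \<alpha> - coefficient g \<alpha>"
  using coefficient_add[of f "- g" \<alpha>] by (simp add: coefficient_uminus)

lemma coefficient_sum: "coefficient (sum f I) \<alpha> = (\<Sum>i\<in>I. coefficient (f i) \<alpha>)"
  by (induction I rule: infinite_finite_induct) (auto simp: coefficient_add)

lemma coefficient_monomial: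
  assumes "\<alpha> \<in> exponents n"
  shows "coefficient (mon \<alpha>) \<beta> = (if \<beta> = \<alpha> then 1 else 0)"
proof -
  have "coefficient (mon \<alpha>) = (\<lambda>\<beta>. if \<beta> = \<alpha> then 1 else 0)"
    by (rule coefficient_eqI[of "{\<alpha>}"]) (use assms in \<open>auto intro: R_closed\<close>)
  then show ?thesis by simp
qed

lemma eq_zero_iff: "f = 0 \<longleftrightarrow> support f = {}"
  using expansion[of f] by (auto simp: support_def)

text \<open>
  The elements whose exponents all lie in \<open>D\<close>. Every error term below is controlled by one of these
  left \<open>R\<close>-submodules: \<open>D\<close> consists of the exponents of small degree, or of those below a given one.
\<close>

definition supported :: "(nat \<Rightarrow> nat) set \<Rightarrow> 'a set" where
  "supported D = {f. support f \<subseteq> D}"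

lemma supported_iff: "f \<in> supported D \<longleftrightarrow> (\<forall>\<alpha>. \<alpha> \<notin> D \<longrightarrow> coefficient f \<alpha> = 0)"
  by (auto simp: supported_def support_def)

lemma supported_zero [simp]: "0 \<in> supported D"
  by (simp add: supported_iff)

lemma supported_add: "f \<in> supported D \<Longrightarrow> g \<in> supported D \<Longrightarrow> f + g \<in> supported D"
  and supported_diff: "f \<in> supported D \<Longrightarrow> g \<in> supported D \<Longrightarrow> f - g \<in> supported D"
  and supported_mult: "r \<in> R \<Longrightarrow> f \<in> supported D \<Longrightarrow> r * f \<in> supported D"
  by (auto simp: supported_iff coefficient_add coefficient_diff coefficient_mult)

lemma supported_sum: "(\<And>i. i \<in> I \<Longrightarrow> f i \<in> supported D) \<Longrightarrow> sum f I \<in> supported D"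
  by (simp add: supported_iff coefficient_sum)

lemma supported_mono: "f \<in> supported D \<Longrightarrow> D \<inter> exponents n \<subseteq> D' \<Longrightarrow> f \<in> supported D'"
  using support_subset[of f] by (auto simp: supported_def)

lemma supported_remove:
  "f \<in> supported (insert \<delta> D) \<Longrightarrow> coefficient f \<delta> = 0 \<Longrightarrow> f \<in> supported D"
  unfolding supported_iff by (metis insertE)

lemma supported_monomial: "\<alpha> \<in> exponents n \<Longrightarrow> \<alpha> \<in> D \<Longrightarrow> mon \<alpha> \<in> supported D"
  by (auto simp: supported_iff coefficient_monomial)

lemma supported_induct [consumes 1, case_names zero add monomial]:
  assumes "f \<in> supported D" and "P 0" and "\<And>f g. P f \<Longrightarrow> P g \<Longrightarrow> P (f + g)"
    and "\<And>r \<alpha>. r \<in> R \<Longrightarrow> \<alpha> \<in> exponents n \<Longrightarrow> \<alpha> \<in> D \<Longrightarrow> P (r * mon \<alpha>)"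
  shows "P f"
proof -
  have "P (\<Sum>\<alpha>\<in>T. coefficient f \<alpha> * mon \<alpha>)" if "finite T" "T \<subseteq> support f" for T
    using that
  proof (induction T rule: finite_induct)
    case (insert \<alpha> T)
    then have "\<alpha> \<in> exponents n" "\<alpha> \<in> D"
      using support_subset[of f] assms(1) by (auto simp: supported_def)
    then show ?case
      using insert assms(3,4) coefficient_in_R by simp
  qed (simp add: assms(2))
  then show ?thesis
    using expansion[of f] finite_support by force
qed


section \<open>Exponents\<close>

lemma exponents_add [intro]: "\<alpha> \<in> exponents n \<Longrightarrow> \<beta> \<in> exponents n \<Longrightarrow> \<alpha> + \<beta> \<in> exponents n"
  and exponents_zero [simp, intro]: "0 \<in> exponents n"
  and exponents_diff [intro]: "\<alpha> \<in> exponents n \<Longrightarrow> \<alpha> - \<beta> \<in> exponents n"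
  by (auto simp: exponents_def)

lemma total_degree_add: "total_degree n (\<alpha> + \<beta>) = total_degree n \<alpha> + total_degree n \<beta>"
  by (simp add: total_degree_def sum.distrib)

lemma total_degree_zero [simp]: "total_degree n 0 = 0"
  by (simp add: total_degree_def)

definition unit_exp :: "nat \<Rightarrow> nat \<Rightarrow> nat" where
  "unit_exp i = (\<lambda>j. if j = i then 1 else 0)"

lemma unit_exp_self: "unit_exp i i = 1"
  by (simp add: unit_exp_def)

lemma exponents_unit_exp [intro]: "i < n \<Longrightarrow> unit_exp i \<in> exponents n"
  by (simp add: exponents_def unit_exp_def)

lemma total_degree_unit_exp [simp]: "i < n \<Longrightarrow> total_degree n (unit_exp i) = 1"
  by (simp add: total_degree_def unit_exp_def)

text \<open>
  Peeling off the variable of least index is the induction that suits the sorted products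
  \<open>mon \<alpha>\<close> and \<open>sigma_pow \<alpha>\<close>, since both are built up by composing from the left.
\<close>

lemma exponent_induct [consumes 1, case_names zero peel]:
  assumes "\<alpha> \<in> exponents n" and "P 0"
    and peel: "\<And>k \<alpha>. k < n \<Longrightarrow> \<alpha> \<in> exponents n \<Longrightarrow> (\<And>i. i < k \<Longrightarrow> \<alpha> i = 0) \<Longrightarrow> P \<alpha> \<Longrightarrow>
      P (unit_exp k + \<alpha>)"
  shows "P \<alpha>"
  using assms(1)
proof (induction "total_degree n \<alpha>" arbitrary: \<alpha> rule: less_induct)
  case less
  show ?case
  proof (cases "\<alpha> = 0")
    case False
    then obtain j where "\<alpha> j \<noteq> 0" by (metis ext zero_fun_apply)
    define k where "k = (LEAST j. \<alpha> j \<noteq> 0)"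
    have k: "\<alpha> k \<noteq> 0"
      unfolding k_def using \<open>\<alpha> j \<noteq> 0\<close> by (rule LeastI)
    have below_k: "\<alpha> i = 0" if "i < k" for i
      using not_less_Least[of i "\<lambda>j. \<alpha> j \<noteq> 0"] that unfolding k_def by blast
    have kn: "k < n"
    proof (rule ccontr)
      assume "\<not> k < n"
      then have "\<alpha> k = 0" using less.prems by (simp add: exponents_def)
      with k show False by simp
    qed
    let ?\<beta> = "\<alpha> - unit_exp k"
    have eq: "\<alpha> = unit_exp k + ?\<beta>"
      using k by (auto simp: fun_eq_iff unit_exp_def)
    have \<beta>: "?\<beta> \<in> exponents n" using less.prems by auto
    have "total_degree n \<alpha> = Suc (total_degree n ?\<beta>)"
      by (subst eq) (simp add: total_degree_add kn)
    then have "P ?\<beta>" using less.hyps \<beta> by simp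
    moreover have "?\<beta> i = 0" if "i < k" for i using below_k[OF that] by simp
    ultimately show ?thesis using peel[OF kn \<beta>] eq by simp
  qed (simp add: assms(2))
qed

lemma monomial_zero [simp]: "mon 0 = 1"
  by (simp add: monomial_def map_replicate_const)

lemma upt_split: "k < n \<Longrightarrow> [0..<n] = [0..<k] @ k # [Suc k..<n]"
  using upt_add_eq_append[of 0 k "n - k"] by (simp add: upt_conv_Cons)

lemma monomial_peel:
  assumes "k < n" "\<And>i. i < k \<Longrightarrow> \<alpha> i = 0"
  shows "mon (unit_exp k + \<alpha>) = x k * mon \<alpha>"
proof -
  have "map (\<lambda>i. x i ^ (unit_exp k + \<alpha>) i) [0..<k] = map (\<lambda>i. x i ^ \<alpha> i) [0..<k]"
    "map (\<lambda>i. x i ^ (unit_exp k + \<alpha>) i) [Suc k..<n] = map (\<lambda>i. x i ^ \<alpha> i) [Suc k..<n]"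
    by (auto simp: unit_exp_def)
  moreover have "(unit_exp k + \<alpha>) k = Suc (\<alpha> k)"
    by (simp add: unit_exp_self)
  moreover have "map (\<lambda>i. x i ^ \<alpha> i) [0..<k] = replicate k 1"
    by (rule nth_equalityI) (auto simp: assms)
  ultimately show ?thesis
    unfolding monomial_def upt_split[OF assms(1)]
    by (simp del: map_eq_conv plus_fun_apply add: mult.assoc)
qed

lemma monomial_unit_exp: "k < n \<Longrightarrow> mon (unit_exp k) = x k"
  using monomial_peel[of k 0] by simp

lemma monomial_pair: "i < j \<Longrightarrow> j < n \<Longrightarrow> mon (unit_exp i + unit_exp j) = x i * x j"
  using monomial_peel[of i "unit_exp j"] monomial_unit_exp[of j] by (simp add: unit_exp_def)

lemma unit_exp_nonzero [simp]: "unit_exp i \<noteq> 0"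
  by (metis unit_exp_def zero_fun_apply zero_neq_one)

end

(* Sums of exponents are to stay sums: evaluating them pointwise would expose lambda terms. *)
declare plus_fun_apply [simp del] zero_fun_apply [simp del]

section \<open>Commutation rules up to lower degree\<close>

context skew_pbw
begin

lemma coefficient_of_R:
  assumes "r \<in> R"
  shows "coefficient r \<alpha> = (if \<alpha> = 0 then r else 0)"
  using coefficient_mult[OF assms, of "mon 0" \<alpha>] coefficient_monomial[of 0 \<alpha>]
  by (simp split: if_splits)

text \<open>
  Throughout, an element given by a definite description is pinned down by comparing coefficients:
  two candidates differ by a multiple of one monomial that must vanish.
\<close>

lemma sigma_unique:
  assumes "i < n" "s \<in> R" "t \<in> R" "x i * r - s * x i \<in> R" "x i * r - t * x i \<in> R"
  shows "s = t"
proof -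
  have "(s - t) * mon (unit_exp i) = (x i * r - t * x i) - (x i * r - s * x i)"
    using assms(1) by (simp add: monomial_unit_exp algebra_simps)
  then have "(s - t) * mon (unit_exp i) \<in> R"
    using assms by (metis diff_in_R)
  then have "coefficient ((s - t) * mon (unit_exp i)) (unit_exp i) = 0"
    by (subst coefficient_of_R) auto
  moreover have "coefficient ((s - t) * mon (unit_exp i)) (unit_exp i) = s - t"
    using assms by (simp add: coefficient_mult coefficient_monomial diff_in_R exponents_unit_exp)
  ultimately show ?thesis by simp
qed

lemma sigma_eqI:
  assumes "i < n" "s \<in> R" "x i * r - s * x i \<in> R"
  shows "sigma i r = s"
  unfolding sigma_def by (rule the_equality) (use assms sigma_unique in auto)

lemma sigma_rule:
  assumes "i < n" "r \<in> R"
  shows "sigma i r \<in> R \<and> x i * r - sigma i r * x i \<in> R"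
proof (cases "r = 0")
  case True
  then show ?thesis
    using sigma_eqI[OF assms(1) zero_in_R, of r] by (simp add: zero_in_R)
next
  case False
  then obtain c where "c \<in> R" "x i * r - c * x i \<in> R"
    using commute_coeff[of i r] assms by auto
  then show ?thesis
    using sigma_eqI[OF assms(1)] by auto
qed

lemmas sigma_in_R = sigma_rule[THEN conjunct1] and delta_in_R = sigma_rule[THEN conjunct2]

lemma sigma_add:
  assumes "i < n" "r \<in> R" "s \<in> R"
  shows "sigma i (r + s) = sigma i r + sigma i s"
proof (rule sigma_eqI)
  have "x i * (r + s) - (sigma i r + sigma i s) * x i
      = (x i * r - sigma i r * x i) + (x i * s - sigma i s * x i)"
    by (simp add: algebra_simps)
  then show "x i * (r + s) - (sigma i r + sigma i s) * x i \<in> R"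
    using assms by (metis add_in_R delta_in_R)
qed (use assms in \<open>auto intro: sigma_in_R add_in_R\<close>)

lemma sigma_mult:
  assumes "i < n" "r \<in> R" "s \<in> R"
  shows "sigma i (r * s) = sigma i r * sigma i s"
proof (rule sigma_eqI)
  have "x i * (r * s) - sigma i r * sigma i s * x i
      = (x i * r - sigma i r * x i) * s + sigma i r * (x i * s - sigma i s * x i)"
    by (simp add: algebra_simps)
  then show "x i * (r * s) - sigma i r * sigma i s * x i \<in> R"
    using assms by (metis add_in_R mult_in_R sigma_in_R delta_in_R)
qed (use assms in \<open>auto intro: sigma_in_R mult_in_R\<close>)

lemma sigma_one: "i < n \<Longrightarrow> sigma i 1 = 1"
  by (rule sigma_eqI) (auto intro: R_closed)

abbreviation low :: "nat \<Rightarrow> 'a set" where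
  "low d \<equiv> supported {\<eta>. total_degree n \<eta> < d}"

lemma low_mono: "f \<in> low d \<Longrightarrow> d \<le> e \<Longrightarrow> f \<in> low e"
  by (erule supported_mono) auto

lemma monomial_low: "\<alpha> \<in> exponents n \<Longrightarrow> total_degree n \<alpha> < d \<Longrightarrow> mon \<alpha> \<in> low d"
  by (rule supported_monomial) auto

lemma low_iff_deg: "f \<in> low d \<longleftrightarrow> f = 0 \<or> deg f < d"
proof (cases "f = 0")
  case False
  then show ?thesis
    using finite_support[of f] eq_zero_iff[of f] by (auto simp: supported_def deg_def)
qed simp

lemma affine_part_low: "affine_part R n x \<subseteq> low 2"
proof
  fix f assume "f \<in> affine_part R n x"
  then obtain r s where f: "f = r + (\<Sum>k<n. s k * x k)" and rs: "r \<in> R" "\<forall>k<n. s k \<in> R"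
    unfolding affine_part_def by blast
  have "r * mon 0 \<in> low 2"
    by (intro supported_mult rs monomial_low) auto
  moreover have "s k * mon (unit_exp k) \<in> low 2" if "k < n" for k
    using that rs by (intro supported_mult monomial_low exponents_unit_exp) auto
  ultimately show "f \<in> low 2"
    unfolding f by (intro supported_add supported_sum) (auto simp: monomial_unit_exp)
qed

lemma c_var_rule:
  assumes "i < j" "j < n"
  shows "c_var i j \<in> R \<and> x j * x i - c_var i j * x i * x j \<in> affine_part R n x"
proof -
  let ?P = "\<lambda>c. c \<in> R \<and> x j * x i - c * x i * x j \<in> affine_part R n x"
  let ?\<epsilon> = "unit_exp i + unit_exp j"
  have \<epsilon>: "?\<epsilon> \<in> exponents n" using assms by (intro exponents_add exponents_unit_exp) auto
  obtain c where c: "?P c"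
    using commute_var[of i j] assms by auto
  moreover have "c = t" if "?P t" for t
  proof -
    have "(c - t) * mon ?\<epsilon> = (x j * x i - t * x i * x j) - (x j * x i - c * x i * x j)"
      using assms by (simp add: monomial_pair algebra_simps)
    also have "\<dots> \<in> low 2"
      by (rule supported_diff) (use c that affine_part_low in auto)
    finally have "coefficient ((c - t) * mon ?\<epsilon>) ?\<epsilon> = 0"
      using assms by (auto simp: supported_iff total_degree_add)
    then show ?thesis
      using c that \<epsilon> by (simp add: coefficient_mult coefficient_monomial diff_in_R)
  qed
  ultimately have "\<exists>!c. ?P c" by auto
  then show ?thesis
    unfolding c_var_def by (rule theI')
qed

definition unit_of_R :: "'a \<Rightarrow> bool" where
  "unit_of_R c \<longleftrightarrow> c \<in> R \<and> (\<exists>d\<in>R. c * d = 1 \<and> d * c = 1)"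

lemma unit_in_R: "unit_of_R c \<Longrightarrow> c \<in> R"
  by (simp add: unit_of_R_def)

lemma unit_one: "unit_of_R 1"
  by (auto simp: unit_of_R_def intro: R_closed)

lemma unit_mult:
  assumes "unit_of_R c" "unit_of_R d"
  shows "unit_of_R (c * d)"
proof -
  obtain c' d' where i: "c' \<in> R" "d' \<in> R" "c * c' = 1" "c' * c = 1" "d * d' = 1" "d' * d = 1"
    using assms by (auto simp: unit_of_R_def)
  have "c * d * (d' * c') = c * (d * d') * c'" "d' * c' * (c * d) = d' * (c' * c) * d"
    by (simp_all only: mult.assoc)
  then show ?thesis
    using i assms unfolding unit_of_R_def by (intro conjI bexI[of _ "d' * c'"]) (auto intro: R_closed)
qed

lemma unit_sigma:
  assumes "i < n" "unit_of_R c"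
  shows "unit_of_R (sigma i c)"
proof -
  obtain d where "d \<in> R" "c * d = 1" "d * c = 1"
    using assms by (auto simp: unit_of_R_def)
  then show ?thesis
    using assms sigma_mult[of i c d] sigma_mult[of i d c] sigma_one[of i]
    unfolding unit_of_R_def by (intro conjI bexI[of _ "sigma i d"]) (auto intro: sigma_in_R)
qed

lemma variable_times_scaled:
  assumes "i < n" "r \<in> R"
  shows "x i * (r * f) = sigma i r * (x i * f) + (x i * r - sigma i r * x i) * f"
  by (simp add: algebra_simps)

text \<open>
  The degree bound is a hypothesis here because the statement serves in the induction that proves
  the bound, where it is known only for monomials of small degree.
\<close>

lemma variable_times_low:
  assumes "i < n" "f \<in> low d"
    and "\<And>\<beta>. \<beta> \<in> exponents n \<Longrightarrow> total_degree n \<beta> < d \<Longrightarrow> x i * mon \<beta> \<in> low (total_degree n \<beta> + 2)"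
  shows "x i * f \<in> low (Suc d)"
  using assms(2)
proof (induction rule: supported_induct)
  case (monomial r \<alpha>)
  then have "x i * mon \<alpha> \<in> low (Suc d)" "mon \<alpha> \<in> low (Suc d)"
    using low_mono[OF assms(3)[of \<alpha>]] monomial_low[of \<alpha>] by auto
  then show ?case
    using monomial assms(1)
    by (subst variable_times_scaled) (auto intro!: supported_add supported_mult sigma_in_R delta_in_R)
qed (auto simp: distrib_left supported_add)

end

context bijective_skew_pbw
begin

lemma unit_c_var: "i < j \<Longrightarrow> j < n \<Longrightarrow> unit_of_R (c_var i j)"
  using c_var_rule c_var_unit by (simp add: unit_of_R_def)

text \<open>
  Sorting a variable into a monomial: if \<open>x i\<close> has to pass the least variable \<open>x k\<close> of the monomial,
  the relation between the two costs the unit \<open>c_var k i\<close>, and everything else that it produces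
  has lower degree, so that the induction on the degree applies to it.
\<close>

lemma variable_times_monomial:
  assumes "i < n" "\<beta> \<in> exponents n"
  shows "\<exists>c. unit_of_R c \<and>
    x i * mon \<beta> - c * mon (unit_exp i + \<beta>) \<in> low (Suc (total_degree n \<beta>))"
  using assms
proof (induction "total_degree n \<beta>" arbitrary: i \<beta> rule: less_induct)
  case less
  have IH: "x l * mon \<gamma> \<in> low (total_degree n \<gamma> + 2)"
    if l: "l < n" "\<gamma> \<in> exponents n" "total_degree n \<gamma> < total_degree n \<beta>" for l \<gamma>
  proof -
    obtain c where c: "unit_of_R c" "x l * mon \<gamma> - c * mon (unit_exp l + \<gamma>) \<in> low (Suc (total_degree n \<gamma>))"
      using less.hyps[OF l(3,1,2)] by auto
    then have "x l * mon \<gamma> - c * mon (unit_exp l + \<gamma>) \<in> low (total_degree n \<gamma> + 2)"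
      by (auto elim: low_mono)
    moreover have "c * mon (unit_exp l + \<gamma>) \<in> low (total_degree n \<gamma> + 2)"
      using c l by (intro supported_mult unit_in_R monomial_low)
        (auto simp: total_degree_add intro: exponents_unit_exp)
    ultimately have "(x l * mon \<gamma> - c * mon (unit_exp l + \<gamma>)) + c * mon (unit_exp l + \<gamma>)
        \<in> low (total_degree n \<gamma> + 2)"
      by (rule supported_add)
    then show ?thesis by simp
  qed
  consider "\<forall>j<i. \<beta> j = 0" | k \<beta>' where "k < i" "\<beta>' \<in> exponents n" "\<forall>j<k. \<beta>' j = 0" "\<beta> = unit_exp k + \<beta>'"
  proof -
    have "(\<forall>j<i. \<beta> j = 0) \<or> (\<exists>k \<beta>'. k < i \<and> \<beta>' \<in> exponents n \<and> (\<forall>j<k. \<beta>' j = 0) \<and> \<beta> = unit_exp k + \<beta>')"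
      using less.prems(2)
    proof (induction rule: exponent_induct)
      case (peel k \<alpha>)
      show ?case
      proof (cases "k < i")
        case False
        then have "\<forall>j<i. (unit_exp k + \<alpha>) j = 0"
          using peel by (simp add: plus_fun_apply unit_exp_def)
        then show ?thesis by simp
      qed (use peel in blast)
    qed (simp add: zero_fun_apply)
    then show thesis using that by blast
  qed
  then show ?case
  proof cases
    case 1
    then have "x i * mon \<beta> - 1 * mon (unit_exp i + \<beta>) = 0"
      using less.prems by (simp add: monomial_peel)
    then show ?thesis using unit_one by (metis supported_zero)
  next
    case (2 k \<beta>')
    let ?d = "total_degree n \<beta>'" and ?c = "c_var k i"
    have kn: "k < n" using 2 less.prems by simp
    have deg: "total_degree n \<beta> = Suc ?d" using 2 kn by (simp add: total_degree_add)
    obtain c' where c': "unit_of_R c'" and p: "x i * mon \<beta>' - c' * mon (unit_exp i + \<beta>') \<in> low (Suc ?d)"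
      using less.hyps[of \<beta>' i] deg 2 less.prems by auto
    let ?p = "x i * mon \<beta>' - c' * mon (unit_exp i + \<beta>')" and ?a = "x i * x k - ?c * x k * x i"
    let ?\<delta> = "x k * c' - sigma k c' * x k" and ?m = "mon (unit_exp i + \<beta>')"
    have mon1: "mon \<beta> = x k * mon \<beta>'"
      using 2 kn by (simp add: monomial_peel)
    have "mon (unit_exp k + (unit_exp i + \<beta>')) = x k * ?m"
      using 2 kn by (intro monomial_peel) (auto simp: unit_exp_def plus_fun_apply)
    then have mon2: "mon (unit_exp i + \<beta>) = x k * ?m"
      using 2 by (simp add: ac_simps)
    have "x i * mon \<beta> - ?c * sigma k c' * mon (unit_exp i + \<beta>)
        = ?c * (?\<delta> * ?m + x k * ?p) + ?a * mon \<beta>'"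
      unfolding mon1 mon2 by (simp add: algebra_simps)
    moreover have "?c * (?\<delta> * ?m + x k * ?p) \<in> low (Suc (Suc ?d))"
    proof (rule supported_mult[OF _ supported_add[OF supported_mult]])
      show "?c \<in> R" using c_var_rule 2 less.prems by simp
      show "?\<delta> \<in> R" by (intro delta_in_R kn unit_in_R c')
      show "?m \<in> low (Suc (Suc ?d))"
        using 2 less.prems by (intro monomial_low) (auto simp: total_degree_add intro: exponents_unit_exp)
      show "x k * ?p \<in> low (Suc (Suc ?d))"
        by (rule variable_times_low[OF kn p]) (rule IH[OF kn], use deg in auto)
    qed
    moreover have "?a * mon \<beta>' \<in> low (Suc (Suc ?d))"
    proof -
      have "?a \<in> affine_part R n x"
        using c_var_rule 2 less.prems by simp
      then obtain r s where a: "?a = r + (\<Sum>l<n. s l * x l)" and rs: "r \<in> R" "\<forall>l<n. s l \<in> R"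
        unfolding affine_part_def by blast
      have "?a * mon \<beta>' = r * mon \<beta>' + (\<Sum>l<n. s l * (x l * mon \<beta>'))"
        unfolding a by (simp add: distrib_right sum_distrib_right mult.assoc)
      also have "\<dots> \<in> low (Suc (Suc ?d))"
        using rs IH[of _ \<beta>'] 2 deg
        by (intro supported_add supported_sum supported_mult[of r] supported_mult[of "s _"] monomial_low) auto
      finally show ?thesis .
    qed
    ultimately have "x i * mon \<beta> - ?c * sigma k c' * mon (unit_exp i + \<beta>) \<in> low (Suc (total_degree n \<beta>))"
      unfolding deg using supported_add by metis
    moreover have "unit_of_R (?c * sigma k c')"
      using 2 less.prems kn c' by (intro unit_mult unit_c_var unit_sigma)
    ultimately show ?thesis by blast
  qed
qed

lemma variable_low:
  assumes "i < n" "f \<in> low d"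
  shows "x i * f \<in> low (Suc d)"
  using assms
proof (rule variable_times_low)
  fix \<beta> assume \<beta>: "\<beta> \<in> exponents n"
  obtain c where "unit_of_R c"
    "x i * mon \<beta> - c * mon (unit_exp i + \<beta>) \<in> low (Suc (total_degree n \<beta>))"
    using variable_times_monomial[OF assms(1) \<beta>] by blast
  then have "(x i * mon \<beta> - c * mon (unit_exp i + \<beta>)) + c * mon (unit_exp i + \<beta>) \<in> low (total_degree n \<beta> + 2)"
    using assms(1) \<beta>
    by (intro supported_add supported_mult unit_in_R monomial_low)
       (auto simp: total_degree_add intro: exponents_unit_exp elim: low_mono)
  then show "x i * mon \<beta> \<in> low (total_degree n \<beta> + 2)" by simp
qed

lemma monomial_times_monomial:
  assumes "\<beta> \<in> exponents n" "\<alpha> \<in> exponents n"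
  shows "\<exists>c. unit_of_R c \<and> mon \<alpha> * mon \<beta> - c * mon (\<alpha> + \<beta>) \<in> low (total_degree n (\<alpha> + \<beta>))"
  using assms(2)
proof (induction rule: exponent_induct)
  case zero
  show ?case by (rule exI[of _ 1]) (simp add: unit_one)
next
  case (peel k \<alpha>)
  then obtain c where c: "unit_of_R c"
    and p: "mon \<alpha> * mon \<beta> - c * mon (\<alpha> + \<beta>) \<in> low (total_degree n (\<alpha> + \<beta>))"
    by blast
  have \<alpha>\<beta>: "\<alpha> + \<beta> \<in> exponents n" using peel assms by blast
  obtain d where d: "unit_of_R d"
    and q: "x k * mon (\<alpha> + \<beta>) - d * mon (unit_exp k + (\<alpha> + \<beta>)) \<in> low (Suc (total_degree n (\<alpha> + \<beta>)))"
    using variable_times_monomial[OF peel(1) \<alpha>\<beta>] by blast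
  have m: "mon (unit_exp k + \<alpha>) = x k * mon \<alpha>"
    by (rule monomial_peel) (use peel in auto)
  have eq: "mon (unit_exp k + \<alpha>) * mon \<beta> - sigma k c * d * mon (unit_exp k + (\<alpha> + \<beta>))
    = x k * (mon \<alpha> * mon \<beta> - c * mon (\<alpha> + \<beta>))
      + (sigma k c * (x k * mon (\<alpha> + \<beta>) - d * mon (unit_exp k + (\<alpha> + \<beta>)))
      + (x k * c - sigma k c * x k) * mon (\<alpha> + \<beta>))"
    unfolding m by (simp add: algebra_simps)
  have "\<dots> \<in> low (Suc (total_degree n (\<alpha> + \<beta>)))"
    using peel c p q \<alpha>\<beta>
    by (intro supported_add variable_low supported_mult monomial_low sigma_in_R delta_in_R unit_in_R) auto
  then show ?case
    using c d peel unfolding eq[symmetric]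
    by (intro exI[of _ "sigma k c * d"]) (auto simp: total_degree_add add.assoc intro: unit_mult unit_sigma)
qed

lemma sigma_pow_zero [simp]: "sigma_pow 0 r = r"
proof -
  have "foldr (\<lambda>i h. (sigma i ^^ (0 :: nat \<Rightarrow> nat) i) \<circ> h) is id = id" for "is"
    by (induction "is") (auto simp: zero_fun_apply)
  then show ?thesis unfolding sigma_pow_def by simp
qed

lemma sigma_pow_peel:
  assumes "k < n" "\<And>i. i < k \<Longrightarrow> \<alpha> i = 0"
  shows "sigma_pow (unit_exp k + \<alpha>) = sigma k \<circ> sigma_pow \<alpha>"
proof -
  define step :: "(nat \<Rightarrow> nat) \<Rightarrow> nat \<Rightarrow> ('a \<Rightarrow> 'a) \<Rightarrow> 'a \<Rightarrow> 'a"
    where "step \<beta> = (\<lambda>i h. (sigma i ^^ \<beta> i) \<circ> h)" for \<beta>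
  have 1: "foldr (step \<beta>) [0..<k] h = h" if "\<And>i. i < k \<Longrightarrow> \<beta> i = 0" for \<beta> h
  proof -
    have "foldr (step \<beta>) [0..<k] h = foldr (\<lambda>i h. h) [0..<k] h"
      by (rule foldr_cong) (auto simp: step_def that)
    also have "foldr (\<lambda>i h. h) (is :: nat list) h = h" for "is" by (induction "is") auto
    finally show ?thesis .
  qed
  have 2: "foldr (step (unit_exp k + \<alpha>)) [Suc k..<n] id = foldr (step \<alpha>) [Suc k..<n] id"
    by (rule foldr_cong) (auto simp: step_def unit_exp_def plus_fun_apply)
  have 3: "step (unit_exp k + \<alpha>) k h = sigma k \<circ> step \<alpha> k h" for h
    by (simp add: step_def unit_exp_self plus_fun_apply comp_assoc)
  have "foldr (step (unit_exp k + \<alpha>)) [0..<n] id = sigma k \<circ> foldr (step \<alpha>) [0..<n] id"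
    unfolding upt_split[OF assms(1)] foldr_append foldr_Cons comp_apply 2 3
    by (subst 1, simp add: assms unit_exp_def plus_fun_apply, subst 1, simp_all add: assms)
  then show ?thesis by (simp add: sigma_pow_def step_def)
qed

lemma sigma_pow_bij: "\<alpha> \<in> exponents n \<Longrightarrow> bij_betw (sigma_pow \<alpha>) R R"
proof (induction rule: exponent_induct)
  case zero
  have "sigma_pow 0 = id" by auto
  then show ?case by (metis bij_betw_id)
next
  case (peel k \<alpha>)
  then show ?case
    using bij_betw_trans[of "sigma_pow \<alpha>" R R "sigma k" R] sigma_bij[of k] by (simp add: sigma_pow_peel comp_def)
qed

lemma sigma_pow_in_R: "\<alpha> \<in> exponents n \<Longrightarrow> r \<in> R \<Longrightarrow> sigma_pow \<alpha> r \<in> R"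
  using sigma_pow_bij bij_betwE by blast

lemma sigma_pow_add:
  "\<alpha> \<in> exponents n \<Longrightarrow> r \<in> R \<Longrightarrow> s \<in> R \<Longrightarrow> sigma_pow \<alpha> (r + s) = sigma_pow \<alpha> r + sigma_pow \<alpha> s"
  by (induction rule: exponent_induct) (simp_all add: sigma_pow_peel sigma_add sigma_pow_in_R)

lemma sigma_pow_mult:
  "\<alpha> \<in> exponents n \<Longrightarrow> r \<in> R \<Longrightarrow> s \<in> R \<Longrightarrow> sigma_pow \<alpha> (r * s) = sigma_pow \<alpha> r * sigma_pow \<alpha> s"
  by (induction rule: exponent_induct) (simp_all add: sigma_pow_peel sigma_mult sigma_pow_in_R)

lemma sigma_pow_of_zero: "\<alpha> \<in> exponents n \<Longrightarrow> sigma_pow \<alpha> 0 = 0"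
  using sigma_pow_add[of \<alpha> 0 0] zero_in_R by simp

lemma sigma_pow_sum:
  assumes "\<alpha> \<in> exponents n" "\<And>i. i \<in> I \<Longrightarrow> f i \<in> R"
  shows "sigma_pow \<alpha> (sum f I) = (\<Sum>i\<in>I. sigma_pow \<alpha> (f i))"
  using assms(2)
  by (induction I rule: infinite_finite_induct)
     (auto simp: sigma_pow_of_zero sigma_pow_add sum_in_R assms(1))

lemma monomial_times_scalar:
  "\<alpha> \<in> exponents n \<Longrightarrow> r \<in> R \<Longrightarrow> mon \<alpha> * r - sigma_pow \<alpha> r * mon \<alpha> \<in> low (total_degree n \<alpha>)"
proof (induction rule: exponent_induct)
  case (peel k \<alpha>)
  let ?s = "sigma_pow \<alpha> r"
  have s: "?s \<in> R" using peel by (simp add: sigma_pow_in_R)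
  have m: "mon (unit_exp k + \<alpha>) = x k * mon \<alpha>"
    by (rule monomial_peel) (use peel in auto)
  have s': "sigma_pow (unit_exp k + \<alpha>) r = sigma k ?s"
    using peel by (simp add: sigma_pow_peel)
  have eq: "mon (unit_exp k + \<alpha>) * r - sigma_pow (unit_exp k + \<alpha>) r * mon (unit_exp k + \<alpha>)
    = x k * (mon \<alpha> * r - ?s * mon \<alpha>) + (x k * ?s - sigma k ?s * x k) * mon \<alpha>"
    unfolding m s' by (simp add: algebra_simps)
  have "\<dots> \<in> low (Suc (total_degree n \<alpha>))"
    using peel s
    by (intro supported_add variable_low supported_mult monomial_low delta_in_R) auto
  then show ?case
    unfolding eq[symmetric] using peel by (simp add: total_degree_add)
qed simp

lemma c_mon_rule:
  assumes "\<alpha> \<in> exponents n" "\<beta> \<in> exponents n"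
  shows "unit_of_R (c_mon \<alpha> \<beta>) \<and>
    mon \<alpha> * mon \<beta> - c_mon \<alpha> \<beta> * mon (\<alpha> + \<beta>) \<in> low (total_degree n (\<alpha> + \<beta>))"
proof -
  let ?p = "\<lambda>c. mon \<alpha> * mon \<beta> - c * mon (\<alpha> + \<beta>)" and ?L = "low (total_degree n (\<alpha> + \<beta>))"
  obtain c where c: "unit_of_R c" "?p c \<in> ?L"
    using monomial_times_monomial[OF assms(2,1)] by blast
  have "c_mon \<alpha> \<beta> = (THE c. c \<in> R \<and> ?p c \<in> ?L)"
    unfolding c_mon_def Let_def low_iff_deg ..
  also have "\<dots> = c"
  proof (rule the_equality)
    fix d assume d: "d \<in> R \<and> ?p d \<in> ?L"
    have "?p d - ?p c = (c - d) * mon (\<alpha> + \<beta>)" by (simp add: algebra_simps)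
    then have "(c - d) * mon (\<alpha> + \<beta>) \<in> ?L"
      using c d supported_diff by metis
    then have "coefficient ((c - d) * mon (\<alpha> + \<beta>)) (\<alpha> + \<beta>) = 0"
      by (simp add: supported_iff)
    then show "d = c"
      using c d assms exponents_add[OF assms]
      by (simp add: coefficient_mult coefficient_monomial unit_in_R diff_in_R)
  qed (use c unit_in_R in auto)
  finally show ?thesis using c by simp
qed

lemmas unit_c_mon = c_mon_rule[THEN conjunct1]

lemma low_times_monomial:
  assumes "\<beta> \<in> exponents n" "f \<in> low d"
  shows "f * mon \<beta> \<in> low (d + total_degree n \<beta>)"
  using assms(2)
proof (induction rule: supported_induct)
  case (monomial r \<alpha>)
  have "(mon \<alpha> * mon \<beta> - c_mon \<alpha> \<beta> * mon (\<alpha> + \<beta>)) + c_mon \<alpha> \<beta> * mon (\<alpha> + \<beta>)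
      \<in> low (d + total_degree n \<beta>)"
    using monomial assms(1) c_mon_rule[of \<alpha> \<beta>]
    by (intro supported_add supported_mult monomial_low)
       (auto simp: total_degree_add unit_in_R elim: low_mono)
  then show ?case
    using monomial by (simp add: mult.assoc supported_mult)
qed (auto simp: distrib_right supported_add)

end

section \<open>Monomial orders and leading coefficients\<close>

locale ordered_skew_pbw = bijective_skew_pbw +
  fixes ord :: "(nat \<Rightarrow> nat) rel"
  assumes monomial_order: "monomial_order ord"
begin

definition below :: "(nat \<Rightarrow> nat) \<Rightarrow> (nat \<Rightarrow> nat) set" where
  "below \<delta> = {\<eta>. (\<eta>, \<delta>) \<in> ord \<and> \<eta> \<noteq> \<delta>}"

abbreviation below_eq :: "(nat \<Rightarrow> nat) \<Rightarrow> (nat \<Rightarrow> nat) set" where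
  "below_eq \<delta> \<equiv> insert \<delta> (below \<delta>)"

lemma linear: "linear_order_on (exponents n) ord"
  and ord_degree: "\<alpha> \<in> exponents n \<Longrightarrow> \<beta> \<in> exponents n \<Longrightarrow> total_degree n \<alpha> < total_degree n \<beta> \<Longrightarrow> (\<alpha>, \<beta>) \<in> ord"
  using monomial_order by (auto simp: monomial_order_def)

lemma ord_exponents: "(\<alpha>, \<beta>) \<in> ord \<Longrightarrow> \<alpha> \<in> exponents n \<and> \<beta> \<in> exponents n"
  and ord_trans: "(\<alpha>, \<beta>) \<in> ord \<Longrightarrow> (\<beta>, \<gamma>) \<in> ord \<Longrightarrow> (\<alpha>, \<gamma>) \<in> ord"
  and ord_antisym: "(\<alpha>, \<beta>) \<in> ord \<Longrightarrow> (\<beta>, \<alpha>) \<in> ord \<Longrightarrow> \<alpha> = \<beta>"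
  using linear unfolding order_on_defs trans_def antisym_def by blast+

lemma ord_refl: "\<alpha> \<in> exponents n \<Longrightarrow> (\<alpha>, \<alpha>) \<in> ord"
  using linear unfolding order_on_defs refl_on_def by blast

lemma ord_total: "\<alpha> \<in> exponents n \<Longrightarrow> \<beta> \<in> exponents n \<Longrightarrow> (\<alpha>, \<beta>) \<in> ord \<or> (\<beta>, \<alpha>) \<in> ord"
  using linear ord_refl[of \<alpha>] by (cases "\<alpha> = \<beta>") (simp_all add: linear_order_on_def total_on_def)

lemma below_exponents: "\<alpha> \<in> below \<beta> \<Longrightarrow> \<alpha> \<in> exponents n"
  and below_degree: "\<alpha> \<in> exponents n \<Longrightarrow> \<beta> \<in> exponents n \<Longrightarrow> total_degree n \<alpha> < total_degree n \<beta> \<Longrightarrow> \<alpha> \<in> below \<beta>"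
  using ord_exponents[of \<alpha> \<beta>] ord_degree[of \<alpha> \<beta>] by (auto simp: below_def)

lemma below_irrefl [simp]: "\<alpha> \<notin> below \<alpha>"
  by (simp add: below_def)

lemma below_trans: "\<alpha> \<in> below \<beta> \<Longrightarrow> \<beta> \<in> below \<gamma> \<Longrightarrow> \<alpha> \<in> below \<gamma>"
  using ord_trans[of \<alpha> \<beta> \<gamma>] ord_antisym[of \<alpha> \<beta>] by (auto simp: below_def)

lemma below_eq_mono: "\<alpha> \<in> below_eq \<beta> \<Longrightarrow> below_eq \<alpha> \<subseteq> below_eq \<beta>"
  and below_eq_below: "\<alpha> \<in> below \<beta> \<Longrightarrow> below_eq \<alpha> \<subseteq> below \<beta>"
  using below_trans[of _ \<alpha> \<beta>] by auto

lemma below_eq_iff: "\<alpha> \<in> exponents n \<Longrightarrow> \<beta> \<in> below_eq \<alpha> \<longleftrightarrow> (\<beta>, \<alpha>) \<in> ord"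
  using ord_refl by (auto simp: below_def)

text \<open>
  The monomials of degree at most \<open>d\<close> are finite in number, and the order refines the degree. So
  every monomial has a finite position in the order, and induction on the position is possible.
\<close>

lemma finite_below: "finite (below \<delta>)"
proof (cases "\<delta> \<in> exponents n")
  case True
  let ?d = "total_degree n \<delta>"
  have "below \<delta> \<subseteq> {\<eta>. \<forall>i. (i \<in> {..<n} \<longrightarrow> \<eta> i \<in> {..?d}) \<and> (i \<notin> {..<n} \<longrightarrow> \<eta> i = 0)}"
  proof
    fix \<eta> assume \<eta>: "\<eta> \<in> below \<delta>"
    have "\<not> ?d < total_degree n \<eta>"
      using \<eta> below_degree[OF True below_exponents[OF \<eta>]] below_trans below_irrefl by blast
    moreover have "\<eta> i \<le> total_degree n \<eta>" if "i < n" for i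
      unfolding total_degree_def by (rule member_le_sum) (use that in auto)
    ultimately show "\<eta> \<in> {\<eta>. \<forall>i. (i \<in> {..<n} \<longrightarrow> \<eta> i \<in> {..?d}) \<and> (i \<notin> {..<n} \<longrightarrow> \<eta> i = 0)}"
      using below_exponents[OF \<eta>] by (auto simp: exponents_def not_less intro: order.trans)
  qed
  then show ?thesis
    by (rule finite_subset) (rule finite_set_of_finite_funs; simp)
next
  case False
  then have "below \<delta> = {}" using ord_exponents by (auto simp: below_def)
  then show ?thesis by simp
qed

lemma card_below_less: "\<alpha> \<in> below \<beta> \<Longrightarrow> card (below \<alpha>) < card (below \<beta>)"
  by (rule psubset_card_mono[OF finite_below]) (use below_eq_below below_irrefl in blast)

lemma finite_set_has_top:
  "finite T \<Longrightarrow> T \<noteq> {} \<Longrightarrow> T \<subseteq> exponents n \<Longrightarrow> \<exists>\<delta>\<in>T. T \<subseteq> below_eq \<delta>"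
proof (induction T rule: finite_ne_induct)
  case (insert \<alpha> T)
  then obtain \<delta> where \<delta>: "\<delta> \<in> T" "T \<subseteq> below_eq \<delta>" by auto
  then have "\<alpha> \<in> below_eq \<delta> \<or> \<delta> \<in> below_eq \<alpha>"
    using insert.prems ord_total[of \<alpha> \<delta>] by (auto simp: below_def)
  then show ?case using \<delta> below_eq_mono by blast
qed auto

lemma lexp_eqI:
  assumes "f \<in> supported (below_eq \<delta>)" "coefficient f \<delta> \<noteq> 0"
  shows "lexp ord f = \<delta>"
proof -
  have \<delta>: "\<delta> \<in> support f" "\<delta> \<in> exponents n"
    using assms support_subset by (auto simp: support_def)
  have sub: "support f \<subseteq> below_eq \<delta>" using assms by (simp add: supported_def)
  show ?thesis
    unfolding lexp_def
  proof (rule the_equality)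
    show "\<delta> \<in> support f \<and> (\<forall>\<beta>\<in>support f. (\<beta>, \<delta>) \<in> ord)"
      using \<delta> sub below_eq_iff by blast
    then show "\<alpha> = \<delta>" if "\<alpha> \<in> support f \<and> (\<forall>\<beta>\<in>support f. (\<beta>, \<alpha>) \<in> ord)" for \<alpha>
      using that ord_antisym by blast
  qed
qed

lemma lexp_top:
  assumes "f \<noteq> 0"
  shows "lexp ord f \<in> support f" "f \<in> supported (below_eq (lexp ord f))"
proof -
  obtain \<delta> where \<delta>: "\<delta> \<in> support f" "support f \<subseteq> below_eq \<delta>"
    using finite_set_has_top[OF finite_support _ support_subset, of f] assms eq_zero_iff[of f] by blast
  then have "lexp ord f = \<delta>"
    by (intro lexp_eqI) (auto simp: supported_def support_def)
  then show "lexp ord f \<in> support f" "f \<in> supported (below_eq (lexp ord f))"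
    using \<delta> by (auto simp: supported_def)
qed

lemma lexp_exponents: "f \<noteq> 0 \<Longrightarrow> lexp ord f \<in> exponents n"
  using lexp_top support_subset by blast

lemma lc_in_R: "lc ord f \<in> R"
  by (simp add: lc_def coefficient_in_R)

lemma lexp_supported: "f \<noteq> 0 \<Longrightarrow> f \<in> supported D \<Longrightarrow> lexp ord f \<in> D"
  using lexp_top by (auto simp: supported_def)

lemma remove_term:
  assumes "\<delta> \<in> exponents n" "f \<in> supported (insert \<delta> D)"
  shows "f - coefficient f \<delta> * mon \<delta> \<in> supported D"
  using assms by (auto simp: supported_iff coefficient_diff coefficient_mult coefficient_in_R coefficient_monomial)

lemma low_supported_below:
  assumes "\<delta> \<in> exponents n" "f \<in> low (total_degree n \<delta>)"
  shows "f \<in> supported (below \<delta>)"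
  using assms(2) by (rule supported_mono) (use below_degree assms(1) in auto)

lemma scaled_product:
  assumes "\<gamma> \<in> exponents n" "\<alpha> \<in> exponents n" "r \<in> R"
  shows "mon \<gamma> * (r * mon \<alpha>) - sigma_pow \<gamma> r * c_mon \<gamma> \<alpha> * mon (\<gamma> + \<alpha>) \<in> supported (below (\<gamma> + \<alpha>))"
proof -
  have q: "(mon \<gamma> * r - sigma_pow \<gamma> r * mon \<gamma>) * mon \<alpha> \<in> low (total_degree n (\<gamma> + \<alpha>))"
    using low_times_monomial[OF assms(2) monomial_times_scalar[OF assms(1,3)]]
    by (simp add: total_degree_add)
  have eq: "mon \<gamma> * (r * mon \<alpha>) - sigma_pow \<gamma> r * c_mon \<gamma> \<alpha> * mon (\<gamma> + \<alpha>)
    = sigma_pow \<gamma> r * (mon \<gamma> * mon \<alpha> - c_mon \<gamma> \<alpha> * mon (\<gamma> + \<alpha>))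
      + (mon \<gamma> * r - sigma_pow \<gamma> r * mon \<gamma>) * mon \<alpha>"
    by (simp add: algebra_simps)
  have "\<dots> \<in> low (total_degree n (\<gamma> + \<alpha>))"
    using q c_mon_rule[OF assms(1,2)] assms
    by (intro supported_add supported_mult[of "sigma_pow \<gamma> r"] sigma_pow_in_R) auto
  then show ?thesis
    unfolding eq using assms by (intro low_supported_below) auto
qed

lemma scaled_product_leading:
  assumes "\<gamma> \<in> exponents n" "\<alpha> \<in> exponents n" "r \<in> R"
  shows "mon \<gamma> * (r * mon \<alpha>) \<in> supported (below_eq (\<gamma> + \<alpha>))"
    and "coefficient (mon \<gamma> * (r * mon \<alpha>)) (\<gamma> + \<alpha>) = sigma_pow \<gamma> r * c_mon \<gamma> \<alpha>"
proof -
  let ?c = "sigma_pow \<gamma> r * c_mon \<gamma> \<alpha>"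
  have c: "?c \<in> R" using assms by (intro mult_in_R sigma_pow_in_R unit_in_R[OF unit_c_mon])
  have e: "\<gamma> + \<alpha> \<in> exponents n" using assms by blast
  have s: "mon \<gamma> * (r * mon \<alpha>) - ?c * mon (\<gamma> + \<alpha>) \<in> supported (below (\<gamma> + \<alpha>))"
    by (rule scaled_product[OF assms])
  have "coefficient (mon \<gamma> * (r * mon \<alpha>) - ?c * mon (\<gamma> + \<alpha>)) (\<gamma> + \<alpha>) = 0"
    using s by (simp add: supported_iff)
  then show "coefficient (mon \<gamma> * (r * mon \<alpha>)) (\<gamma> + \<alpha>) = ?c"
    using c e by (simp add: coefficient_diff coefficient_mult coefficient_monomial)
  have "(mon \<gamma> * (r * mon \<alpha>) - ?c * mon (\<gamma> + \<alpha>)) + ?c * mon (\<gamma> + \<alpha>) \<in> supported (below_eq (\<gamma> + \<alpha>))"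
    by (rule supported_add[OF supported_mono[OF s] supported_mult[OF c supported_monomial[OF e]]]) auto
  then show "mon \<gamma> * (r * mon \<alpha>) \<in> supported (below_eq (\<gamma> + \<alpha>))" by simp
qed

text \<open>
  Multiplication by a monomial is strictly monotone: the leading exponents of the two products that
  the definition of a monomial order compares are the sums of the exponents, as all other terms
  have lower degree.
\<close>

lemma below_shift:
  assumes "\<alpha> \<in> below \<beta>" "\<gamma> \<in> exponents n"
  shows "\<gamma> + \<alpha> \<in> below (\<gamma> + \<beta>)"
proof -
  have \<alpha>: "\<alpha> \<in> exponents n" and \<beta>: "\<beta> \<in> exponents n" and ab: "(\<alpha>, \<beta>) \<in> ord"
    using assms(1) ord_exponents by (auto simp: below_def)
  have lexp: "lexp ord (mon \<gamma> * mon \<eta>) = \<gamma> + \<eta>" and nonzero: "mon \<gamma> * mon \<eta> \<noteq> 0"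
    if \<eta>: "\<eta> \<in> exponents n" for \<eta>
  proof -
    have one: "sigma_pow \<gamma> 1 \<noteq> 0"
      using bij_betw_imp_inj_on[OF sigma_pow_bij[OF assms(2)]] sigma_pow_of_zero[OF assms(2)]
        one_in_R zero_in_R by (metis inj_on_contraD one_neq_zero)
    obtain d where d: "c_mon \<gamma> \<eta> * d = 1"
      using unit_c_mon[OF assms(2) \<eta>] by (auto simp: unit_of_R_def)
    have "sigma_pow \<gamma> 1 * c_mon \<gamma> \<eta> \<noteq> 0"
    proof
      assume "sigma_pow \<gamma> 1 * c_mon \<gamma> \<eta> = 0"
      then have "sigma_pow \<gamma> 1 * (c_mon \<gamma> \<eta> * d) = 0" by (simp add: mult.assoc[symmetric])
      then show False using one d by simp
    qed
    then have c: "coefficient (mon \<gamma> * mon \<eta>) (\<gamma> + \<eta>) \<noteq> 0"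
      using scaled_product_leading(2)[OF assms(2) \<eta> one_in_R] by simp
    show "lexp ord (mon \<gamma> * mon \<eta>) = \<gamma> + \<eta>"
      using scaled_product_leading(1)[OF assms(2) \<eta> one_in_R] c by (intro lexp_eqI) auto
    show "mon \<gamma> * mon \<eta> \<noteq> 0" using c by (metis coefficient_zero)
  qed
  have "\<forall>\<mu>\<in>exponents n. lm_le ord (mon \<gamma> * mon \<alpha> * mon \<mu>) (mon \<gamma> * mon \<beta> * mon \<mu>)"
    using monomial_order \<alpha> \<beta> ab assms(2) by (simp add: monomial_order_def)
  then have "lm_le ord (mon \<gamma> * mon \<alpha> * mon 0) (mon \<gamma> * mon \<beta> * mon 0)" by blast
  then have "(\<gamma> + \<alpha>, \<gamma> + \<beta>) \<in> ord"
    using lexp nonzero \<alpha> \<beta> by (simp add: lm_le_def)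
  then show ?thesis
    using assms(1) by (simp add: below_def)
qed

lemma below_shift_right: "\<alpha> \<in> below \<beta> \<Longrightarrow> \<gamma> \<in> exponents n \<Longrightarrow> \<alpha> + \<gamma> \<in> below (\<beta> + \<gamma>)"
  and below_eq_shift_right: "\<alpha> \<in> below_eq \<beta> \<Longrightarrow> \<gamma> \<in> exponents n \<Longrightarrow> \<alpha> + \<gamma> \<in> below_eq (\<beta> + \<gamma>)"
  using below_shift by (auto simp: add.commute)

lemma monomial_times_below:
  assumes "\<gamma> \<in> exponents n" "f \<in> supported (below \<beta>)"
  shows "mon \<gamma> * f \<in> supported (below (\<gamma> + \<beta>))"
  using assms(2)
proof (induction rule: supported_induct)
  case (monomial r \<alpha>)
  then show ?case
    using below_eq_below[OF below_shift[OF monomial(3) assms(1)]]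
    by (intro supported_mono[OF scaled_product_leading(1)[OF assms(1)]]) auto
qed (auto simp: distrib_left supported_add)

lemma monomial_times_below_eq:
  assumes "\<gamma> \<in> exponents n" "\<beta> \<in> exponents n" "f \<in> supported (below_eq \<beta>)"
  shows "mon \<gamma> * f \<in> supported (below_eq (\<gamma> + \<beta>))"
    and "coefficient (mon \<gamma> * f) (\<gamma> + \<beta>) = sigma_pow \<gamma> (coefficient f \<beta>) * c_mon \<gamma> \<beta>"
proof -
  let ?t = "coefficient f \<beta> * mon \<beta>"
  have rest: "mon \<gamma> * (f - ?t) \<in> supported (below (\<gamma> + \<beta>))"
    by (rule monomial_times_below[OF assms(1) remove_term[OF assms(2,3)]])
  have eq: "mon \<gamma> * f = mon \<gamma> * ?t + mon \<gamma> * (f - ?t)" by (simp add: algebra_simps)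
  note top = scaled_product_leading[OF assms(1,2) coefficient_in_R, of f \<beta>]
  show "mon \<gamma> * f \<in> supported (below_eq (\<gamma> + \<beta>))"
    unfolding eq by (rule supported_add[OF top(1) supported_mono[OF rest]]) auto
  show "coefficient (mon \<gamma> * f) (\<gamma> + \<beta>) = sigma_pow \<gamma> (coefficient f \<beta>) * c_mon \<gamma> \<beta>"
    unfolding eq coefficient_add top(2) using rest by (simp add: supported_iff)
qed

lemma below_times_below_eq:
  assumes "p \<in> supported (below \<alpha>)" "f \<in> supported (below_eq \<beta>)" "\<beta> \<in> exponents n"
  shows "p * f \<in> supported (below (\<alpha> + \<beta>))"
  using assms(1)
proof (induction rule: supported_induct)
  case (monomial r \<eta>)
  have "mon \<eta> * f \<in> supported (below (\<alpha> + \<beta>))"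
    using monomial_times_below_eq(1)[OF monomial(2) assms(3,2)]
    by (rule supported_mono) (use below_eq_below[OF below_shift_right[OF monomial(3) assms(3)]] in auto)
  then show ?case using monomial(1) by (simp add: mult.assoc supported_mult)
qed (auto simp: distrib_right supported_add)

text \<open>
  Associativity of \<open>mon \<theta> * mon \<gamma> * (r * mon \<beta>)\<close>, read off at the leading exponent. How
  \<open>sigma_pow\<close> composes and how shifted leading coefficients are translated both follow from it.
\<close>

lemma c_mon_cocycle:
  assumes "\<theta> \<in> exponents n" "\<gamma> \<in> exponents n" "\<beta> \<in> exponents n" "r \<in> R"
  shows "sigma_pow \<theta> (sigma_pow \<gamma> r * c_mon \<gamma> \<beta>) * c_mon \<theta> (\<gamma> + \<beta>)
    = c_mon \<theta> \<gamma> * (sigma_pow (\<theta> + \<gamma>) r * c_mon (\<theta> + \<gamma>) \<beta>)"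
proof -
  let ?f = "r * mon \<beta>" and ?p = "mon \<theta> * mon \<gamma> - c_mon \<theta> \<gamma> * mon (\<theta> + \<gamma>)"
  have f: "?f \<in> supported (below_eq \<beta>)"
    using assms by (intro supported_mult supported_monomial) auto
  have e: "\<gamma> + \<beta> \<in> exponents n" "\<theta> + \<gamma> \<in> exponents n" using assms by blast+
  note g = scaled_product_leading[OF assms(2,3,4)]
  have "sigma_pow \<theta> (sigma_pow \<gamma> r * c_mon \<gamma> \<beta>) * c_mon \<theta> (\<gamma> + \<beta>)
      = coefficient (mon \<theta> * (mon \<gamma> * ?f)) (\<theta> + (\<gamma> + \<beta>))"
    using monomial_times_below_eq(2)[OF assms(1) e(1) g(1)] g(2) by simp
  also have "mon \<theta> * (mon \<gamma> * ?f) = c_mon \<theta> \<gamma> * (mon (\<theta> + \<gamma>) * ?f) + ?p * ?f"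
    by (simp add: algebra_simps)
  also have "coefficient \<dots> (\<theta> + (\<gamma> + \<beta>))
      = c_mon \<theta> \<gamma> * coefficient (mon (\<theta> + \<gamma>) * ?f) (\<theta> + \<gamma> + \<beta>) + coefficient (?p * ?f) (\<theta> + \<gamma> + \<beta>)"
    using unit_c_mon[OF assms(1,2)] by (simp add: coefficient_add coefficient_mult unit_in_R add.assoc)
  also have "coefficient (?p * ?f) (\<theta> + \<gamma> + \<beta>) = 0"
    using below_times_below_eq[OF low_supported_below f assms(3)] c_mon_rule[OF assms(1,2)] e(2)
    by (simp add: supported_iff)
  finally show ?thesis
    using scaled_product_leading(2)[OF e(2) assms(3,4)] by simp
qed

text \<open>The value is \<open>sigma_pow \<gamma> 1 * c_mon \<gamma> 0 = 1\<close>, and a bijective multiplicative map fixes \<open>1\<close>.\<close>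

lemma c_mon_zero: "\<gamma> \<in> exponents n \<Longrightarrow> c_mon \<gamma> 0 = 1"
proof -
  assume \<gamma>: "\<gamma> \<in> exponents n"
  have "1 \<in> sigma_pow \<gamma> ` R"
    using sigma_pow_bij[OF \<gamma>] one_in_R by (simp add: bij_betw_def)
  then obtain r where r: "r \<in> R" "sigma_pow \<gamma> r = 1" by force
  then have "sigma_pow \<gamma> 1 = 1"
    using sigma_pow_mult[OF \<gamma> one_in_R, of r] by simp
  then show ?thesis
    using scaled_product_leading(2)[OF \<gamma> exponents_zero one_in_R] \<gamma> by (simp add: coefficient_monomial)
qed

text \<open>
  \<open>sigma_pow\<close> is additive in the exponent only up to conjugation by \<open>c_mon\<close>, because the single
  \<open>sigma i\<close> commute only up to such a conjugation.
\<close>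

lemma sigma_pow_twisted:
  assumes "\<theta> \<in> exponents n" "\<gamma> \<in> exponents n" "r \<in> R"
  shows "sigma_pow \<theta> (sigma_pow \<gamma> r) * c_mon \<theta> \<gamma> = c_mon \<theta> \<gamma> * sigma_pow (\<theta> + \<gamma>) r"
  using c_mon_cocycle[OF assms(1,2) exponents_zero assms(3)] assms
  by (simp add: c_mon_zero exponents_add)

end

section \<open>Representations with bounded leading exponents\<close>

context ordered_skew_pbw
begin

text \<open>
  Left combinations of \<open>G\<close> in which no single term has its leading exponent outside \<open>D\<close>, although
  terms may cancel. For \<open>D = below \<delta>\<close> these are the standard representations of Buchberger's
  criterion, and for \<open>D = UNIV\<close> they form the left ideal generated by \<open>G\<close>.
\<close>

definition rep :: "'a set \<Rightarrow> (nat \<Rightarrow> nat) set \<Rightarrow> 'a set" where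
  "rep G D = {\<Sum>g\<in>G. a g * g | a. \<forall>g\<in>G. a g \<in> supported {\<alpha>. \<alpha> + lexp ord g \<in> D}}"

lemma repI:
  assumes "\<And>g. g \<in> G \<Longrightarrow> a g \<in> supported {\<alpha>. \<alpha> + lexp ord g \<in> D}" and "f = (\<Sum>g\<in>G. a g * g)"
  shows "f \<in> rep G D"
  unfolding rep_def using assms by blast

lemma repE:
  assumes "f \<in> rep G D"
  obtains a where "\<And>g. g \<in> G \<Longrightarrow> a g \<in> supported {\<alpha>. \<alpha> + lexp ord g \<in> D}" "f = (\<Sum>g\<in>G. a g * g)"
  using assms unfolding rep_def by blast

lemma rep_zero: "0 \<in> rep G D"
  by (rule repI[of G "\<lambda>g. 0"]) auto

lemma rep_add:
  assumes "f \<in> rep G D" "h \<in> rep G D"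
  shows "f + h \<in> rep G D"
proof -
  obtain a where "\<And>g. g \<in> G \<Longrightarrow> a g \<in> supported {\<alpha>. \<alpha> + lexp ord g \<in> D}" "f = (\<Sum>g\<in>G. a g * g)"
    using assms(1) by (elim repE) auto
  moreover obtain b where "\<And>g. g \<in> G \<Longrightarrow> b g \<in> supported {\<alpha>. \<alpha> + lexp ord g \<in> D}" "h = (\<Sum>g\<in>G. b g * g)"
    using assms(2) by (elim repE) auto
  ultimately show ?thesis
    by (intro repI[of G "\<lambda>g. a g + b g"]) (auto simp: distrib_right sum.distrib intro: supported_add)
qed

lemma rep_left_mult:
  assumes "f \<in> rep G D"
    and "\<And>g a. g \<in> G \<Longrightarrow> a \<in> supported {\<alpha>. \<alpha> + lexp ord g \<in> D} \<Longrightarrow> c * a \<in> supported {\<alpha>. \<alpha> + lexp ord g \<in> D'}"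
  shows "c * f \<in> rep G D'"
proof -
  obtain a where a: "\<And>g. g \<in> G \<Longrightarrow> a g \<in> supported {\<alpha>. \<alpha> + lexp ord g \<in> D}" "f = (\<Sum>g\<in>G. a g * g)"
    using assms(1) by (elim repE) auto
  show ?thesis
    by (rule repI[of G "\<lambda>g. c * a g"]) (use a assms(2) in \<open>auto simp: sum_distrib_left mult.assoc\<close>)
qed

lemma rep_scale: "r \<in> R \<Longrightarrow> f \<in> rep G D \<Longrightarrow> r * f \<in> rep G D"
  by (erule rep_left_mult) (rule supported_mult)

lemma rep_diff: "f \<in> rep G D \<Longrightarrow> h \<in> rep G D \<Longrightarrow> f - h \<in> rep G D"
  using rep_add[of f G D "-1 * h"] rep_scale[of "-1" h G D] uminus_in_R[OF one_in_R] by simp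

lemma rep_sum: "(\<And>i. i \<in> I \<Longrightarrow> f i \<in> rep G D) \<Longrightarrow> sum f I \<in> rep G D"
  by (induction I rule: infinite_finite_induct) (auto intro: rep_add rep_zero)

lemma rep_mono_exponents: "f \<in> rep G D \<Longrightarrow> D \<subseteq> D' \<Longrightarrow> f \<in> rep G D'"
  by (erule repE) (rule repI, rule supported_mono, auto)

lemma rep_single:
  assumes "finite G" "g \<in> G" "a \<in> supported {\<alpha>. \<alpha> + lexp ord g \<in> D}"
  shows "a * g \<in> rep G D"
proof (rule repI[of G "\<lambda>h. if h = g then a else 0"])
  have "(\<Sum>h\<in>G. (if h = g then a else 0) * h) = (\<Sum>h\<in>G. if h = g then a * h else 0)"
    by (rule sum.cong) auto
  then show "a * g = (\<Sum>h\<in>G. (if h = g then a else 0) * h)"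
    using assms by simp
qed (use assms in auto)

lemma rep_mono_generators:
  assumes "f \<in> rep G D" "G \<subseteq> H" "finite H"
  shows "f \<in> rep H D"
  using assms(1)
proof (rule repE)
  fix a assume "\<And>g. g \<in> G \<Longrightarrow> a g \<in> supported {\<alpha>. \<alpha> + lexp ord g \<in> D}" "f = (\<Sum>g\<in>G. a g * g)"
  then show ?thesis using assms by (auto intro!: rep_sum rep_single)
qed

lemma rep_supported:
  assumes "f \<in> rep G (below \<delta>)" "0 \<notin> G"
  shows "f \<in> supported (below \<delta>)"
  using assms(1)
proof (rule repE)
  fix a assume a: "\<And>g. g \<in> G \<Longrightarrow> a g \<in> supported {\<alpha>. \<alpha> + lexp ord g \<in> below \<delta>}"
    and f: "f = (\<Sum>g\<in>G. a g * g)"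
  have "c * g \<in> supported (below \<delta>)"
    if g: "g \<in> G" and c: "c \<in> supported {\<alpha>. \<alpha> + lexp ord g \<in> below \<delta>}" for g c
    using c
  proof (induction rule: supported_induct)
    case (monomial r \<alpha>)
    have "g \<noteq> 0" using g assms(2) by auto
    then have "mon \<alpha> * g \<in> supported (below_eq (\<alpha> + lexp ord g))"
      using monomial by (intro monomial_times_below_eq lexp_exponents lexp_top)
    then have "mon \<alpha> * g \<in> supported (below \<delta>)"
      by (rule supported_mono) (use monomial below_eq_below in auto)
    then show ?case using monomial by (simp add: mult.assoc supported_mult)
  qed (auto simp: distrib_right supported_add)
  then show ?thesis unfolding f by (intro supported_sum) (use a in auto)
qed

lemma rep_monomial_mult:
  assumes "\<theta> \<in> exponents n" "f \<in> rep G (below \<delta>)" "0 \<notin> G"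
  shows "mon \<theta> * f \<in> rep G (below (\<theta> + \<delta>))"
  using assms(2)
proof (rule rep_left_mult)
  fix g a assume g: "g \<in> G" and a: "a \<in> supported {\<alpha>. \<alpha> + lexp ord g \<in> below \<delta>}"
  have lg: "lexp ord g \<in> exponents n" using g assms(3) lexp_exponents by metis
  show "mon \<theta> * a \<in> supported {\<alpha>. \<alpha> + lexp ord g \<in> below (\<theta> + \<delta>)}"
    using a
  proof (induction rule: supported_induct)
    case (monomial r \<alpha>)
    have "\<eta> + lexp ord g \<in> below (\<theta> + \<delta>)" if "\<eta> \<in> below_eq (\<theta> + \<alpha>)" for \<eta>
    proof -
      have "\<theta> + (\<alpha> + lexp ord g) \<in> below (\<theta> + \<delta>)"
        using monomial assms(1) by (intro below_shift) auto
      moreover have "\<eta> + lexp ord g \<in> below_eq (\<theta> + (\<alpha> + lexp ord g))"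
        using below_eq_shift_right[OF that lg] by (simp add: add.assoc)
      ultimately show ?thesis using below_eq_below by blast
    qed
    then show ?case
      by (intro supported_mono[OF scaled_product_leading(1)[OF assms(1) monomial(2,1)]]) auto
  qed (auto simp: distrib_left supported_add)
qed

lemma left_ideal_rep: "left_ideal UNIV (rep G UNIV)"
proof -
  have "c * f \<in> rep G UNIV" if "f \<in> rep G UNIV" for c f
    using that by (rule rep_left_mult) (simp add: supported_def)
  then show ?thesis
    unfolding left_ideal_def using rep_zero rep_add by auto
qed

lemma left_ideal_sum:
  assumes "left_ideal R' I" "\<And>i. i \<in> T \<Longrightarrow> f i \<in> I"
  shows "sum f T \<in> I"
  using assms(2) by (induction T rule: infinite_finite_induct) (use assms(1) in \<open>auto simp: left_ideal_def\<close>)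

lemma left_ideal_hull: "left_ideal UNIV (left_ideal UNIV hull F)"
  by (rule hull_in) (auto simp: left_ideal_def)

lemma hull_eq_rep:
  assumes "finite F"
  shows "left_ideal UNIV hull F = rep F UNIV"
proof
  have "F \<subseteq> rep F UNIV"
  proof
    fix g assume "g \<in> F"
    then have "1 * g \<in> rep F UNIV" by (intro rep_single assms) (auto simp: supported_def)
    then show "g \<in> rep F UNIV" by simp
  qed
  then show "left_ideal UNIV hull F \<subseteq> rep F UNIV"
    using left_ideal_rep by (intro hull_minimal)
  show "rep F UNIV \<subseteq> left_ideal UNIV hull F"
  proof
    fix f assume "f \<in> rep F UNIV"
    then show "f \<in> left_ideal UNIV hull F"
    proof (rule repE)
      fix a assume "f = (\<Sum>g\<in>F. a g * g)"
      moreover have "a g * g \<in> left_ideal UNIV hull F" if "g \<in> F" for g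
        using left_ideal_hull[of F] hull_inc[OF that, of "left_ideal UNIV"] by (simp add: left_ideal_def)
      ultimately show ?thesis
        using left_ideal_sum[OF left_ideal_hull, of F "\<lambda>g. a g * g" F] by simp
    qed
  qed
qed


section \<open>Shifting generators to a common leading exponent\<close>

lemma cofactor_exponents: "\<delta> \<in> exponents n \<Longrightarrow> cofactor ord \<delta> g \<in> exponents n"
  by (simp add: cofactor_def exponents_diff)

lemma cofactor_add: "lexp ord g \<le> \<delta> \<Longrightarrow> cofactor ord \<delta> g + lexp ord g = \<delta>"
  by (auto simp: cofactor_def fun_eq_iff le_fun_def plus_fun_apply)

lemma cofactor_unique: "\<alpha> + lexp ord g = \<delta> \<Longrightarrow> \<alpha> = cofactor ord \<delta> g \<and> lexp ord g \<le> \<delta>"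
  by (drule sym) (simp add: cofactor_def fun_eq_iff le_fun_def plus_fun_apply)

lemma shifted_lc_in_R: "g \<noteq> 0 \<Longrightarrow> \<delta> \<in> exponents n \<Longrightarrow> shifted_lc ord \<delta> g \<in> R"
  unfolding shifted_lc_def
  by (intro mult_in_R sigma_pow_in_R cofactor_exponents lc_in_R unit_in_R[OF unit_c_mon] lexp_exponents)

lemma shifted_product:
  assumes "g \<noteq> 0" "\<delta> \<in> exponents n" "lexp ord g \<le> \<delta>"
  shows "mon (cofactor ord \<delta> g) * g \<in> supported (below_eq \<delta>)"
    and "coefficient (mon (cofactor ord \<delta> g) * g) \<delta> = shifted_lc ord \<delta> g"
  using monomial_times_below_eq[OF cofactor_exponents[OF assms(2), of g] lexp_exponents[OF assms(1)] lexp_top(2)[OF assms(1)]]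
  by (simp_all add: cofactor_add[OF assms(3)] shifted_lc_def lc_def)

text \<open>
  The shifted leading coefficients at \<open>\<theta> + \<delta>\<close> arise from those at \<open>\<delta>\<close> by \<open>sigma_pow \<theta>\<close>, up to units.
  The left unit depends on \<open>g\<close> and rescales the entries of a syzygy one by one; the right one is
  common to all \<open>g\<close> and can be cancelled.
\<close>

lemma shifted_lc_shift:
  assumes "g \<noteq> 0" "\<delta> \<in> exponents n" "\<theta> \<in> exponents n" "lexp ord g \<le> \<delta>"
  shows "c_mon \<theta> (cofactor ord \<delta> g) * shifted_lc ord (\<theta> + \<delta>) g
    = sigma_pow \<theta> (shifted_lc ord \<delta> g) * c_mon \<theta> \<delta>"
proof -
  have "\<theta> + cofactor ord \<delta> g = cofactor ord (\<theta> + \<delta>) g"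
    using cofactor_unique[of "\<theta> + cofactor ord \<delta> g" g "\<theta> + \<delta>"] cofactor_add[OF assms(4)]
    by (simp add: add.assoc)
  then show ?thesis
    using c_mon_cocycle[OF assms(3) cofactor_exponents[OF assms(2), of g] lexp_exponents[OF assms(1)] lc_in_R[of g]]
    by (simp add: shifted_lc_def cofactor_add[OF assms(4)])
qed

text \<open>
  A generator \<open>g\<close> can contribute a term at the bound \<open>\<delta>\<close> only if its leading exponent divides \<open>\<delta>\<close>,
  and then through the single monomial \<open>cofactor ord \<delta> g\<close> of its multiplier. The rest lies below.
\<close>

lemma rep_split_top:
  assumes "finite G" "0 \<notin> G" "\<delta> \<in> exponents n" "f \<in> rep G (below_eq \<delta>)"
  obtains r where "\<And>g. r g \<in> R"
    "f - (\<Sum>g\<in>{g\<in>G. lexp ord g \<le> \<delta>}. r g * (mon (cofactor ord \<delta> g) * g)) \<in> rep G (below \<delta>)"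
    "coefficient f \<delta> = (\<Sum>g\<in>{g\<in>G. lexp ord g \<le> \<delta>}. r g * shifted_lc ord \<delta> g)"
proof -
  let ?S = "{g \<in> G. lexp ord g \<le> \<delta>}"
  obtain a where a: "\<And>g. g \<in> G \<Longrightarrow> a g \<in> supported {\<alpha>. \<alpha> + lexp ord g \<in> below_eq \<delta>}"
    and f: "f = (\<Sum>g\<in>G. a g * g)"
    using assms(4) by (elim repE) auto
  define r where "r g = coefficient (a g) (cofactor ord \<delta> g)" for g
  define t where "t g = (if lexp ord g \<le> \<delta> then r g * mon (cofactor ord \<delta> g) else 0)" for g
  have r: "r g \<in> R" for g by (simp add: r_def coefficient_in_R)
  let ?s = "\<Sum>g\<in>?S. r g * (mon (cofactor ord \<delta> g) * g)"
  have s: "?s = (\<Sum>g\<in>G. t g * g)"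
    by (rule sum.mono_neutral_cong_left) (use assms(1) in \<open>auto simp: t_def mult.assoc\<close>)
  have rest: "f - ?s \<in> rep G (below \<delta>)"
  proof (rule repI)
    show "f - ?s = (\<Sum>g\<in>G. (a g - t g) * g)"
      unfolding s f by (simp add: left_diff_distrib sum_subtractf)
    show "a g - t g \<in> supported {\<alpha>. \<alpha> + lexp ord g \<in> below \<delta>}" if g: "g \<in> G" for g
    proof (cases "lexp ord g \<le> \<delta>")
      case True
      have "a g \<in> supported (insert (cofactor ord \<delta> g) {\<alpha>. \<alpha> + lexp ord g \<in> below \<delta>})"
        by (rule supported_mono[OF a[OF g]]) (use cofactor_unique in blast)
      then show ?thesis
        using remove_term[OF cofactor_exponents[OF assms(3)]] True by (simp add: t_def r_def)
    next
      case False
      have "a g \<in> supported {\<alpha>. \<alpha> + lexp ord g \<in> below \<delta>}"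
        by (rule supported_mono[OF a[OF g]]) (use False cofactor_unique in blast)
      then show ?thesis using False by (simp add: t_def)
    qed
  qed
  have "coefficient f \<delta> = coefficient ?s \<delta> + coefficient (f - ?s) \<delta>"
    by (simp add: coefficient_diff)
  also have "coefficient (f - ?s) \<delta> = 0"
    using rep_supported[OF rest assms(2)] by (simp add: supported_iff)
  also have "coefficient ?s \<delta> = (\<Sum>g\<in>?S. r g * shifted_lc ord \<delta> g)"
    unfolding coefficient_sum
  proof (rule sum.cong)
    fix g assume g: "g \<in> ?S"
    then have "g \<noteq> 0" using assms(2) by auto
    then show "coefficient (r g * (mon (cofactor ord \<delta> g) * g)) \<delta> = r g * shifted_lc ord \<delta> g"
      using g assms(3) r by (simp add: coefficient_mult shifted_product)
  qed simp
  finally have "coefficient f \<delta> = (\<Sum>g\<in>?S. r g * shifted_lc ord \<delta> g)" by simp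
  then show thesis using that r rest by blast
qed

lemma lcm_exp_least:
  assumes "finite S" "S \<noteq> {}" "\<And>g. g \<in> S \<Longrightarrow> lexp ord g \<le> \<delta>"
  shows "lcm_exp ord S \<le> \<delta>"
  using assms by (auto simp: lcm_exp_def le_fun_def)

lemma lcm_exp_upper: "finite S \<Longrightarrow> g \<in> S \<Longrightarrow> lexp ord g \<le> lcm_exp ord S"
  by (auto simp: lcm_exp_def le_fun_def)

lemma lcm_exp_exponents:
  assumes "finite S" "S \<noteq> {}" "0 \<notin> S"
  shows "lcm_exp ord S \<in> exponents n"
proof -
  have "lexp ord g i = 0" if "n \<le> i" "g \<in> S" for g i
    using lexp_exponents[of g] assms(3) that by (auto simp: exponents_def)
  then have "(\<lambda>g. lexp ord g i) ` S = {0}" if "n \<le> i" for i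
    using that assms(2) by (auto simp: image_iff)
  then show ?thesis by (simp add: exponents_def lcm_exp_def)
qed

lemma sum_list_zip_nth:
  "length bs = length gs \<Longrightarrow> (\<Sum>(b, g)\<leftarrow>zip bs gs. h b g) = (\<Sum>j<length gs. h (bs ! j) (gs ! j))"
  by (simp add: sum_list_sum_nth atLeast0LessThan)

lemma left_solution_map:
  assumes "distinct gs" "\<And>g. g \<in> set gs \<Longrightarrow> r g \<in> R"
  shows "left_solution R a (map h gs) (map r gs) \<longleftrightarrow> a = (\<Sum>g\<in>set gs. r g * h g)"
proof -
  have "zip (map r gs) (map h gs) = map (\<lambda>g. (r g, h g)) gs"
    by (induction gs) auto
  then have "(\<Sum>(b, c)\<leftarrow>zip (map r gs) (map h gs). b * c) = (\<Sum>g\<in>set gs. r g * h g)"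
    using assms(1) by (simp add: sum_list_distinct_conv_sum_set comp_def)
  then show ?thesis using assms(2) by (auto simp: left_solution_def)
qed


section \<open>Buchberger's criterion\<close>

text \<open>
  Representations below the least common multiple are demanded for one generating set of syzygies
  only, the one that a run of the algorithm happens to use. By linearity all syzygies inherit them.
\<close>

definition syzygies_reduce :: "'a set \<Rightarrow> 'a set \<Rightarrow> bool" where
  "syzygies_reduce G S \<longleftrightarrow> (\<exists>gs B. set gs = S \<and> distinct gs \<and>
     generates_Syz R (map (shifted_lc ord (lcm_exp ord S)) gs) B \<and>
     (\<forall>b\<in>B. shifted_sum ord (lcm_exp ord S) b gs \<in> rep G (below (lcm_exp ord S))))"

lemma syzygies_reduce_all:
  assumes "syzygies_reduce G S" "\<And>g. g \<in> S \<Longrightarrow> b g \<in> R"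
    and "(\<Sum>g\<in>S. b g * shifted_lc ord (lcm_exp ord S) g) = 0"
  shows "(\<Sum>g\<in>S. b g * (mon (cofactor ord (lcm_exp ord S) g) * g)) \<in> rep G (below (lcm_exp ord S))"
proof -
  let ?X = "lcm_exp ord S"
  obtain gs B where gs: "set gs = S" "distinct gs"
    and B: "generates_Syz R (map (shifted_lc ord ?X) gs) B"
    and BG: "\<And>b. b \<in> B \<Longrightarrow> shifted_sum ord ?X b gs \<in> rep G (below ?X)"
    using assms(1) unfolding syzygies_reduce_def by blast
  have "map b gs \<in> Syz R (map (shifted_lc ord ?X) gs)"
    unfolding Syz_def mem_Collect_eq
    by (subst left_solution_map) (use gs assms in auto)
  then obtain q where q: "\<And>s. s \<in> B \<Longrightarrow> q s \<in> R"
    and bs: "map b gs = map (\<lambda>j. \<Sum>s\<in>B. q s * s ! j) [0..<length gs]"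
    using B unfolding generates_Syz_def length_map by blast
  have len: "length s = length gs" if "s \<in> B" for s
    using B that by (auto simp: generates_Syz_def Syz_def left_solution_def)
  have bj: "b (gs ! j) = (\<Sum>s\<in>B. q s * s ! j)" if "j < length gs" for j
    using arg_cong[OF bs, of "\<lambda>l. l ! j"] that by simp
  let ?m = "\<lambda>g. mon (cofactor ord ?X g) * g"
  have "(\<Sum>g\<in>S. b g * ?m g) = (\<Sum>j<length gs. b (gs ! j) * ?m (gs ! j))"
    using sum.reindex_bij_betw[OF bij_betw_nth[OF gs(2) refl gs(1)[symmetric]], of "\<lambda>g. b g * ?m g"] by simp
  also have "\<dots> = (\<Sum>j<length gs. \<Sum>s\<in>B. q s * (s ! j * ?m (gs ! j)))"
    by (rule sum.cong) (auto simp: bj sum_distrib_right mult.assoc)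
  also have "\<dots> = (\<Sum>s\<in>B. q s * (\<Sum>j<length gs. s ! j * ?m (gs ! j)))"
    by (subst sum.swap) (simp add: sum_distrib_left)
  also have "\<dots> = (\<Sum>s\<in>B. q s * shifted_sum ord ?X s gs)"
    by (rule sum.cong) (simp_all add: shifted_sum_def sum_list_zip_nth len mult.assoc)
  also have "\<dots> \<in> rep G (below ?X)"
    by (intro rep_sum rep_scale q BG)
  finally show ?thesis .
qed

text \<open>
  If the terms at the bound \<open>\<delta>\<close> cancel, their coefficients form a syzygy at \<open>\<delta>\<close> of the generators
  \<open>S\<close> whose leading monomials divide \<open>\<delta>\<close>. Since the \<open>c_mon\<close> are units and \<open>sigma_pow \<theta>\<close> is
  bijective, it comes from a syzygy at the least common multiple \<open>X = \<delta> - \<theta>\<close>: multiplying that one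
  by \<open>mon \<theta>\<close> from the left changes the terms at \<open>\<delta>\<close> only by terms below \<open>\<delta>\<close>. There the
  representations of the generating syzygies apply.
\<close>

lemma lower_representation:
  assumes G: "finite G" "0 \<notin> G" and S: "\<And>S. S \<subseteq> G \<Longrightarrow> S \<noteq> {} \<Longrightarrow> syzygies_reduce G S"
    and \<delta>: "\<delta> \<in> exponents n" and f: "f \<in> rep G (below_eq \<delta>)" "coefficient f \<delta> = 0"
  shows "f \<in> rep G (below \<delta>)"
proof -
  define S where "S = {g \<in> G. lexp ord g \<le> \<delta>}"
  obtain r where r: "\<And>g. r g \<in> R"
    and rest: "f - (\<Sum>g\<in>S. r g * (mon (cofactor ord \<delta> g) * g)) \<in> rep G (below \<delta>)"
    and "coefficient f \<delta> = (\<Sum>g\<in>S. r g * shifted_lc ord \<delta> g)"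
    using rep_split_top[OF G \<delta> f(1)] unfolding S_def by blast
  then have syz: "(\<Sum>g\<in>S. r g * shifted_lc ord \<delta> g) = 0" using f(2) by simp
  have SG: "S \<subseteq> G" "finite S" "0 \<notin> S" using G by (auto simp: S_def)
  show ?thesis
  proof (cases "S = {}")
    case True
    then show ?thesis using rest by simp
  next
    case False
    define X where "X = lcm_exp ord S"
    define \<theta> where "\<theta> = \<delta> - X"
    have X: "X \<in> exponents n"
      unfolding X_def by (rule lcm_exp_exponents[OF SG(2) False SG(3)])
    have \<theta>: "\<theta> \<in> exponents n" unfolding \<theta>_def using \<delta> by (rule exponents_diff)
    have "X \<le> \<delta>"
      unfolding X_def using SG False by (intro lcm_exp_least) (auto simp: S_def)
    then have \<theta>X: "\<theta> + X = \<delta>" by (auto simp: \<theta>_def fun_eq_iff le_fun_def plus_fun_apply)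
    have gX: "lexp ord g \<le> X" "g \<noteq> 0" if "g \<in> S" for g
      using lcm_exp_upper[OF SG(2) that] SG(3) that by (auto simp: X_def)
    (* b is the syzygy at X with sigma_pow \<theta> (b g) * u g = r g *)
    define u where "u g = c_mon \<theta> (cofactor ord X g)" for g
    have "\<exists>v. v \<in> R \<and> u g * v = 1 \<and> v * u g = 1" for g
      using unit_c_mon[OF \<theta> cofactor_exponents[OF X]] unfolding u_def unit_of_R_def by blast
    then obtain v where v: "\<And>g. v g \<in> R" "\<And>g. v g * u g = 1" by metis
    have "\<exists>b\<in>R. sigma_pow \<theta> b = r g * v g" for g
      using sigma_pow_bij[OF \<theta>] mult_in_R[OF r v(1)] by (metis bij_betw_iff_bijections)
    then obtain b where b: "\<And>g. b g \<in> R" "\<And>g. sigma_pow \<theta> (b g) = r g * v g" by metis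
    have slc: "shifted_lc ord X g \<in> R" if "g \<in> S" for g
      using gX that X by (intro shifted_lc_in_R)
    have "(\<Sum>g\<in>S. b g * shifted_lc ord X g) = 0"
    proof -
      let ?y = "\<Sum>g\<in>S. b g * shifted_lc ord X g"
      have y: "?y \<in> R" using b slc by (intro sum_in_R mult_in_R)
      have "sigma_pow \<theta> ?y * c_mon \<theta> X = (\<Sum>g\<in>S. r g * v g * (sigma_pow \<theta> (shifted_lc ord X g) * c_mon \<theta> X))"
        using \<theta> b slc by (simp add: sigma_pow_sum mult_in_R sigma_pow_mult sum_distrib_right mult.assoc)
      also have "\<dots> = (\<Sum>g\<in>S. r g * shifted_lc ord \<delta> g)"
      proof (rule sum.cong)
        fix g assume g: "g \<in> S"
        have "sigma_pow \<theta> (shifted_lc ord X g) * c_mon \<theta> X = u g * shifted_lc ord \<delta> g"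
          using shifted_lc_shift[OF gX(2)[OF g] X \<theta> gX(1)[OF g]] \<theta>X by (simp add: u_def)
        then have "r g * v g * (sigma_pow \<theta> (shifted_lc ord X g) * c_mon \<theta> X)
            = r g * (v g * u g) * shifted_lc ord \<delta> g"
          by (simp only: mult.assoc)
        then show "r g * v g * (sigma_pow \<theta> (shifted_lc ord X g) * c_mon \<theta> X) = r g * shifted_lc ord \<delta> g"
          using v by simp
      qed simp
      finally have 0: "sigma_pow \<theta> ?y * c_mon \<theta> X = 0" using syz by simp
      obtain w where "c_mon \<theta> X * w = 1"
        using unit_c_mon[OF \<theta> X] by (auto simp: unit_of_R_def)
      then have "sigma_pow \<theta> ?y = sigma_pow \<theta> ?y * c_mon \<theta> X * w" by (simp add: mult.assoc)
      then have "sigma_pow \<theta> ?y = sigma_pow \<theta> 0" using 0 sigma_pow_of_zero[OF \<theta>] by simp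
      then show ?thesis
        using bij_betw_imp_inj_on[OF sigma_pow_bij[OF \<theta>]] y zero_in_R by (blast dest: inj_onD)
    qed
    then have "(\<Sum>g\<in>S. b g * (mon (cofactor ord X g) * g)) \<in> rep G (below X)"
      unfolding X_def using S[OF SG(1) False] b by (intro syzygies_reduce_all) auto
    then have lifted: "mon \<theta> * (\<Sum>g\<in>S. b g * (mon (cofactor ord X g) * g)) \<in> rep G (below \<delta>)"
      using rep_monomial_mult[OF \<theta> _ G(2)] \<theta>X by metis
    (* the choice of b makes the leading terms of the two multipliers of g agree *)
    have "(r g * mon (cofactor ord \<delta> g) - mon \<theta> * (b g * mon (cofactor ord X g))) * g \<in> rep G (below \<delta>)"
      if g: "g \<in> S" for g
    proof (rule rep_single)
      have co: "cofactor ord \<delta> g = \<theta> + cofactor ord X g"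
        using cofactor_unique[of "\<theta> + cofactor ord X g" g \<delta>] cofactor_add[OF gX(1)[OF g]] \<theta>X
        by (simp add: add.assoc)
      have "sigma_pow \<theta> (b g) * c_mon \<theta> (cofactor ord X g) = r g"
        using v b by (simp add: u_def[symmetric] mult.assoc)
      then have "mon \<theta> * (b g * mon (cofactor ord X g)) - r g * mon (cofactor ord \<delta> g)
          \<in> supported (below (cofactor ord \<delta> g))"
        using scaled_product[OF \<theta> cofactor_exponents[OF X] b(1), of g] co by metis
      then have "r g * mon (cofactor ord \<delta> g) - mon \<theta> * (b g * mon (cofactor ord X g))
          \<in> supported (below (cofactor ord \<delta> g))"
        using supported_diff[OF supported_zero] by fastforce
      then show "r g * mon (cofactor ord \<delta> g) - mon \<theta> * (b g * mon (cofactor ord X g))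
          \<in> supported {\<alpha>. \<alpha> + lexp ord g \<in> below \<delta>}"
      proof (rule supported_mono)
        have "lexp ord g \<le> \<delta>" using g by (simp add: S_def)
        then show "below (cofactor ord \<delta> g) \<inter> exponents n \<subseteq> {\<alpha>. \<alpha> + lexp ord g \<in> below \<delta>}"
          using below_shift_right[OF _ lexp_exponents[OF gX(2)[OF g]]] cofactor_add by force
      qed
    qed (use g SG G in auto)
    then have "(\<Sum>g\<in>S. (r g * mon (cofactor ord \<delta> g) - mon \<theta> * (b g * mon (cofactor ord X g))) * g) \<in> rep G (below \<delta>)"
      by (rule rep_sum)
    also have "(\<Sum>g\<in>S. (r g * mon (cofactor ord \<delta> g) - mon \<theta> * (b g * mon (cofactor ord X g))) * g)
        = (\<Sum>g\<in>S. r g * (mon (cofactor ord \<delta> g) * g)) - mon \<theta> * (\<Sum>g\<in>S. b g * (mon (cofactor ord X g) * g))"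
      by (simp add: left_diff_distrib sum_subtractf sum_distrib_left mult.assoc)
    finally show ?thesis
      using rep_add[OF rep_add[OF _ lifted] rest] by fastforce
  qed
qed

lemma reducibleI:
  assumes "f \<noteq> 0" "distinct gs" "set gs \<subseteq> G" "\<And>g. g \<in> set gs \<Longrightarrow> lexp ord g \<le> lexp ord f"
    and "\<And>g. g \<in> set gs \<Longrightarrow> r g \<in> R" "lc ord f = (\<Sum>g\<in>set gs. r g * shifted_lc ord (lexp ord f) g)"
  shows "reducible ord (left_solution R) G f"
proof -
  have "left_solution R (lc ord f) (map (shifted_lc ord (lexp ord f)) gs) (map r gs)"
    using assms by (subst left_solution_map) auto
  then show ?thesis
    using assms unfolding reducible_def reduces_def by blast
qed

text \<open>Either the bound \<open>\<delta>\<close> is attained as the leading exponent, or the representation can be lowered.\<close>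

lemma rep_reducible:
  assumes G: "finite G" "0 \<notin> G" and S: "\<And>S. S \<subseteq> G \<Longrightarrow> S \<noteq> {} \<Longrightarrow> syzygies_reduce G S"
  shows "\<delta> \<in> exponents n \<Longrightarrow> f \<in> rep G (below_eq \<delta>) \<Longrightarrow> f \<noteq> 0 \<Longrightarrow> reducible ord (left_solution R) G f"
proof (induction "card (below \<delta>)" arbitrary: \<delta> rule: less_induct)
  case less
  show ?case
  proof (cases "coefficient f \<delta> = 0")
    case True
    have low: "f \<in> rep G (below \<delta>)"
      by (rule lower_representation[OF G S less.prems(1,2) True])
    then have "below \<delta> \<noteq> {}"
      using rep_supported[OF low G(2)] lexp_supported[OF less.prems(3)] by blast
    then obtain \<delta>' where \<delta>': "\<delta>' \<in> below \<delta>" "below \<delta> \<subseteq> below_eq \<delta>'"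
      using finite_set_has_top[OF finite_below] below_exponents by blast
    show ?thesis
      using less.hyps[OF card_below_less[OF \<delta>'(1)]] below_exponents[OF \<delta>'(1)]
        rep_mono_exponents[OF low \<delta>'(2)] less.prems(3) by blast
  next
    case False
    obtain r where r: "\<And>g. r g \<in> R"
      and rest: "f - (\<Sum>g\<in>{g\<in>G. lexp ord g \<le> \<delta>}. r g * (mon (cofactor ord \<delta> g) * g)) \<in> rep G (below \<delta>)"
      and lc: "coefficient f \<delta> = (\<Sum>g\<in>{g\<in>G. lexp ord g \<le> \<delta>}. r g * shifted_lc ord \<delta> g)"
      using rep_split_top[OF G less.prems(1,2)] by blast
    let ?s = "\<Sum>g\<in>{g\<in>G. lexp ord g \<le> \<delta>}. r g * (mon (cofactor ord \<delta> g) * g)"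
    have "?s \<in> supported (below_eq \<delta>)"
      using G less.prems by (intro supported_sum supported_mult r shifted_product) auto
    then have "?s + (f - ?s) \<in> supported (below_eq \<delta>)"
      by (rule supported_add) (rule supported_mono[OF rep_supported[OF rest G(2)]], auto)
    then have lexp: "lexp ord f = \<delta>" using False by (intro lexp_eqI) simp_all
    obtain gs where gs: "set gs = {g \<in> G. lexp ord g \<le> \<delta>}" "distinct gs"
      using finite_distinct_list[of "{g \<in> G. lexp ord g \<le> \<delta>}"] G by auto
    show ?thesis
      using less.prems(3) gs r lc lexp by (intro reducibleI[of f gs G r]) (auto simp: lc_def)
  qed
qed

lemma buchberger_criterion:
  assumes G: "finite G" "0 \<notin> G" and S: "\<And>S. S \<subseteq> G \<Longrightarrow> S \<noteq> {} \<Longrightarrow> syzygies_reduce G S"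
    and f: "f \<in> rep G UNIV" "f \<noteq> 0"
  shows "reducible ord (left_solution R) G f"
  using f(1)
proof (rule repE)
  fix a assume a: "f = (\<Sum>g\<in>G. a g * g)"
  define D where "D = (\<Union>g\<in>G. (\<lambda>\<alpha>. \<alpha> + lexp ord g) ` support (a g))"
  have D: "finite D" "D \<subseteq> exponents n"
  proof -
    show "finite D" by (simp add: D_def G finite_support)
    show "D \<subseteq> exponents n"
    proof
      fix \<eta> assume "\<eta> \<in> D"
      then obtain g \<alpha> where "g \<in> G" "\<alpha> \<in> support (a g)" "\<eta> = \<alpha> + lexp ord g"
        by (auto simp: D_def)
      moreover from this have "g \<noteq> 0" using G by auto
      ultimately show "\<eta> \<in> exponents n"
        using support_subset[of "a g"] lexp_exponents[of g] by (simp add: exponents_add subset_iff)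
    qed
  qed
  have rep: "f \<in> rep G D"
    by (rule repI[OF _ a]) (auto simp: supported_def D_def)
  have "D \<noteq> {}"
  proof
    assume "D = {}"
    then have "a g = 0" if "g \<in> G" for g using that by (auto simp: D_def eq_zero_iff)
    then show False using f(2) a by simp
  qed
  then obtain \<delta> where "\<delta> \<in> D" "D \<subseteq> below_eq \<delta>"
    using finite_set_has_top[OF D(1) _ D(2)] by blast
  then show ?thesis
    using rep_reducible[OF G S _ rep_mono_exponents[OF rep] f(2)] D(2) by blast
qed

end

section \<open>Sequences of irreducible elements are finite\<close>

lemma nat_sequence_ascending_subsequence:
  fixes s :: "nat \<Rightarrow> nat"
  obtains \<phi> :: "nat \<Rightarrow> nat" where "strict_mono \<phi>" "\<And>k l. k \<le> l \<Longrightarrow> s (\<phi> k) \<le> s (\<phi> l)"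
proof -
  obtain \<phi> :: "nat \<Rightarrow> nat" where \<phi>: "strict_mono \<phi>" "monoseq (\<lambda>k. s (\<phi> k))"
    using seq_monosub[of s] by blast
  from \<phi>(2) consider "\<forall>k l. k \<le> l \<longrightarrow> s (\<phi> k) \<le> s (\<phi> l)" | "\<forall>k l. k \<le> l \<longrightarrow> s (\<phi> l) \<le> s (\<phi> k)"
    unfolding monoseq_def by blast
  then show thesis
  proof cases
    case 1
    show thesis by (rule that[OF \<phi>(1)]) (use 1 in auto)
  next
    case 2
    (* a descending sequence of naturals is constant from where it attains its minimum *)
    obtain N where N: "\<And>k. s (\<phi> N) \<le> s (\<phi> k)"
      using ex_has_least_nat[of "\<lambda>_. True" 0 "\<lambda>k. s (\<phi> k)"] by auto
    have "strict_mono (\<lambda>k. \<phi> (N + k))"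
      using \<phi>(1) by (simp add: strict_mono_def)
    moreover have "s (\<phi> (N + k)) \<le> s (\<phi> (N + l))" for k l
      using 2 N[of "N + l"] by (meson le_add1 le_trans)
    ultimately show thesis by (rule that)
  qed
qed

text \<open>Dickson's lemma, by passing to subsequences one component after the other.\<close>

lemma dickson_subsequence:
  fixes e :: "nat \<Rightarrow> nat \<Rightarrow> nat"
  shows "\<exists>\<phi> :: nat \<Rightarrow> nat. strict_mono \<phi> \<and> (\<forall>i<m. \<forall>k l. k \<le> l \<longrightarrow> e (\<phi> k) i \<le> e (\<phi> l) i)"
proof (induction m)
  case 0
  show ?case by (intro exI[of _ "id :: nat \<Rightarrow> nat"]) (simp add: strict_mono_def)
next
  case (Suc m)
  then obtain \<phi> :: "nat \<Rightarrow> nat" where \<phi>: "strict_mono \<phi>" "\<And>i k l. i < m \<Longrightarrow> k \<le> l \<Longrightarrow> e (\<phi> k) i \<le> e (\<phi> l) i"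
    by blast
  obtain \<psi> :: "nat \<Rightarrow> nat" where \<psi>: "strict_mono \<psi>" "\<And>k l. k \<le> l \<Longrightarrow> e (\<phi> (\<psi> k)) m \<le> e (\<phi> (\<psi> l)) m"
    using nat_sequence_ascending_subsequence[of "\<lambda>k. e (\<phi> k) m"] by blast
  have "e (\<phi> (\<psi> k)) i \<le> e (\<phi> (\<psi> l)) i" if "i < Suc m" "k \<le> l" for i k l
  proof (cases "i = m")
    case False
    then show ?thesis
      using that \<phi>(2)[of i "\<psi> k" "\<psi> l"] strict_mono_less_eq[OF \<psi>(1), of k l] by simp
  qed (use \<psi>(2) that in simp)
  then show ?case
    using strict_mono_o[OF \<phi>(1) \<psi>(1)] by (intro exI[of _ "\<lambda>k. \<phi> (\<psi> k)"]) (simp add: comp_def)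
qed

context ordered_skew_pbw
begin

text \<open>The ascending chain of the left ideals \<open>J k\<close> generated by the first \<open>k\<close> terms becomes stationary.\<close>

lemma noetherian_sequence:
  assumes "left_noetherian R" and d: "\<And>k. d k \<in> R"
  obtains k :: nat and s where "\<And>i. s i \<in> R" "d k = (\<Sum>i<k. s i * d i)"
proof -
  define J where "J k = {\<Sum>i<k. s i * d i | s. \<forall>i. s i \<in> R}" for k :: nat
  have J_I: "(\<Sum>i<k. s i * d i) \<in> J k" if "\<And>i. s i \<in> R" for s k
    using that unfolding J_def by blast
  have J_add: "a + b \<in> J k" if "a \<in> J k" "b \<in> J k" for a b k
  proof -
    obtain s t where st: "\<And>i. s i \<in> R" "a = (\<Sum>i<k. s i * d i)" "\<And>i. t i \<in> R" "b = (\<Sum>i<k. t i * d i)"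
      using \<open>a \<in> J k\<close> \<open>b \<in> J k\<close> unfolding J_def by blast
    then have "a + b = (\<Sum>i<k. (s i + t i) * d i)" by (simp add: distrib_right sum.distrib)
    then show ?thesis using J_I[of "\<lambda>i. s i + t i" k] st add_in_R by simp
  qed
  have J_mult: "r * a \<in> J k" if "r \<in> R" "a \<in> J k" for r a k
  proof -
    obtain s where s: "\<And>i. s i \<in> R" "a = (\<Sum>i<k. s i * d i)"
      using \<open>a \<in> J k\<close> unfolding J_def by blast
    then have "r * a = (\<Sum>i<k. r * s i * d i)" by (simp add: sum_distrib_left mult.assoc)
    then show ?thesis using J_I[of "\<lambda>i. r * s i" k] s \<open>r \<in> R\<close> mult_in_R by simp
  qed
  have J_mono: "J k \<subseteq> J l" if "k \<le> l" for k l
  proof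
    fix a assume "a \<in> J k"
    then obtain s where s: "\<And>i. s i \<in> R" "a = (\<Sum>i<k. s i * d i)"
      unfolding J_def by blast
    have "a = (\<Sum>i<l. (if i < k then s i else 0) * d i)"
      unfolding s(2) by (rule sum.mono_neutral_cong_left) (use that in auto)
    then show "a \<in> J l" using J_I[of "\<lambda>i. if i < k then s i else 0" l] s zero_in_R by simp
  qed
  have J_zero: "0 \<in> J k" for k
    using J_I[of "\<lambda>_. 0" k] zero_in_R by simp
  have J_R: "J k \<subseteq> R" for k
    unfolding J_def using d by (auto intro!: sum_in_R mult_in_R)
  have J_ideal: "left_ideal R (J k)" for k
    unfolding left_ideal_def using J_R J_zero J_add J_mult by blast
  have "a + b \<in> (\<Union>k. J k)" if ab: "a \<in> (\<Union>k. J k)" "b \<in> (\<Union>k. J k)" for a b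
  proof -
    obtain k l where "a \<in> J k" "b \<in> J l" using ab by auto
    then have "a \<in> J (max k l)" "b \<in> J (max k l)"
      using J_mono[of k "max k l"] J_mono[of l "max k l"] by auto
    then show ?thesis using J_add[of a "max k l" b] by auto
  qed
  then have "left_ideal R (\<Union>k. J k)"
    using J_R J_zero unfolding left_ideal_def by (auto dest: J_mult)
  with assms(1) have "\<exists>X. finite X \<and> X \<subseteq> R \<and> (\<Union>k. J k) = left_ideal R hull X"
    unfolding left_noetherian_def by (elim allE impE)
  then obtain X where X: "finite X" "(\<Union>k. J k) = left_ideal R hull X"
    by (elim exE conjE)
  have X_J: "X \<subseteq> (\<Union>k. J k)"
    unfolding X(2) by (rule hull_subset)
  have "\<exists>k. X \<subseteq> J k"
    using X(1) X_J
  proof (induction X rule: finite_induct)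
    case (insert a Y)
    then obtain k l where "Y \<subseteq> J k" "a \<in> J l" by blast
    then have "insert a Y \<subseteq> J (max k l)"
      using J_mono[of k "max k l"] J_mono[of l "max k l"] by auto
    then show ?case by blast
  qed simp
  then obtain k where "X \<subseteq> J k" by blast
  then have "left_ideal R hull X \<subseteq> J k"
    using J_ideal by (intro hull_minimal)
  moreover have "d k \<in> J (Suc k)"
  proof -
    have "(\<Sum>i<Suc k. (if i = k then 1 else 0) * d i) = d k"
      by (simp add: if_distrib[of "\<lambda>c. c * _"] cong: if_cong)
    then show ?thesis using J_I[of "\<lambda>i. if i = k then 1 else 0" "Suc k"] one_in_R zero_in_R by simp
  qed
  ultimately have "d k \<in> J k" unfolding X(2)[symmetric] by blast
  then show thesis using that unfolding J_def by blast
qed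

text \<open>
  The normalised coefficient \<open>d\<close> of \<open>g\<close> is the one that stands to the right of its leading monomial,
  \<open>g = mon \<beta> * d + \<dots>\<close>. In these terms the coefficient to be matched at any \<open>\<delta> \<ge> \<beta>\<close> is, up to a unit,
  the image of the same \<open>d\<close> under \<open>sigma_pow \<delta>\<close>. Reducibility thus becomes membership in the
  left ideal that the normalised coefficients of the available generators generate.
\<close>

lemma shifted_lc_normalised:
  assumes "g \<noteq> 0" "\<delta> \<in> exponents n" "lexp ord g \<le> \<delta>" "d \<in> R" "sigma_pow (lexp ord g) d = lc ord g"
  obtains v where "v \<in> R" "sigma_pow \<delta> d = v * shifted_lc ord \<delta> g"
proof -
  let ?\<gamma> = "cofactor ord \<delta> g" and ?\<beta> = "lexp ord g"
  have \<gamma>: "?\<gamma> \<in> exponents n" and \<beta>: "?\<beta> \<in> exponents n"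
    using assms by (auto intro: cofactor_exponents lexp_exponents)
  obtain v where v: "v \<in> R" "v * c_mon ?\<gamma> ?\<beta> = 1"
    using unit_c_mon[OF \<gamma> \<beta>] unfolding unit_of_R_def by blast
  have "shifted_lc ord \<delta> g = c_mon ?\<gamma> ?\<beta> * sigma_pow \<delta> d"
    unfolding shifted_lc_def assms(5)[symmetric] sigma_pow_twisted[OF \<gamma> \<beta> assms(4)] cofactor_add[OF assms(3)] ..
  then have "v * shifted_lc ord \<delta> g = sigma_pow \<delta> d"
    using v(2) by (simp add: mult.assoc[symmetric])
  then show thesis using that[OF v(1)] by simp
qed

text \<open>
  The sets \<open>G\<close> may be larger than the initial segments of the sequence, since a run of the
  algorithm starts with the given generators.
\<close>

lemma no_irreducible_sequence:
  fixes r :: "nat \<Rightarrow> 'a"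
  assumes "left_noetherian R"
  shows "\<exists>k. \<forall>G. r ` {..<k} \<subseteq> G \<longrightarrow> r k \<noteq> 0 \<longrightarrow> reducible ord (left_solution R) G (r k)"
proof (rule ccontr)
  assume "\<not> ?thesis"
  then have "\<forall>k. \<exists>G. r ` {..<k} \<subseteq> G \<and> r k \<noteq> 0 \<and> \<not> reducible ord (left_solution R) G (r k)" by blast
  then obtain G where G: "\<And>k. r ` {..<k} \<subseteq> G k" and nz: "\<And>k. r k \<noteq> 0"
    and irr: "\<And>k. \<not> reducible ord (left_solution R) (G k) (r k)" by metis
  obtain \<phi> :: "nat \<Rightarrow> nat" where \<phi>: "strict_mono \<phi>" and up: "\<And>i k l. i < n \<Longrightarrow> k \<le> l \<Longrightarrow> lexp ord (r (\<phi> k)) i \<le> lexp ord (r (\<phi> l)) i"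
    using dickson_subsequence[of n "\<lambda>k. lexp ord (r k)"] by blast
  define g where "g k = r (\<phi> k)" for k
  have g: "g k \<noteq> 0" "lexp ord (g k) \<in> exponents n" for k
    using nz lexp_exponents by (auto simp: g_def)
  have div: "lexp ord (g k) \<le> lexp ord (g l)" if "k \<le> l" for k l
  proof (rule le_funI)
    fix i show "lexp ord (g k) i \<le> lexp ord (g l) i"
      using up[OF _ that, of i] g(2)[of k] by (cases "i < n") (auto simp: g_def exponents_def)
  qed
  have "\<exists>d\<in>R. sigma_pow (lexp ord (g k)) d = lc ord (g k)" for k
    using sigma_pow_bij[OF g(2)] lc_in_R by (metis bij_betw_iff_bijections)
  then obtain d where d: "\<And>k. d k \<in> R" "\<And>k. sigma_pow (lexp ord (g k)) (d k) = lc ord (g k)" by metis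
  obtain k s where s: "\<And>i. s i \<in> R" and dk: "d k = (\<Sum>i<k. s i * d i)"
    by (rule noetherian_sequence[OF assms d(1)]) (rule that)
  let ?\<delta> = "lexp ord (g k)"
  have "\<exists>v. v \<in> R \<and> (i < k \<longrightarrow> sigma_pow ?\<delta> (d i) = v * shifted_lc ord ?\<delta> (g i))" for i
  proof (cases "i < k")
    case True
    then show ?thesis
      using shifted_lc_normalised[OF g(1) g(2) div d, of i k] by (metis less_imp_le)
  qed (use zero_in_R in auto)
  then obtain v where v: "\<And>i. v i \<in> R" "\<And>i. i < k \<Longrightarrow> sigma_pow ?\<delta> (d i) = v i * shifted_lc ord ?\<delta> (g i)"
    by metis
  have "lc ord (g k) = (\<Sum>i<k. sigma_pow ?\<delta> (s i) * v i * shifted_lc ord ?\<delta> (g i))"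
    unfolding d(2)[symmetric] using g(2) s d(1) v
    by (simp add: dk sigma_pow_sum mult_in_R sigma_pow_mult mult.assoc)
  then have "left_solution R (lc ord (g k)) (map (\<lambda>i. shifted_lc ord ?\<delta> (g i)) [0..<k]) (map (\<lambda>i. sigma_pow ?\<delta> (s i) * v i) [0..<k])"
    using g(2) s v(1) by (subst left_solution_map) (auto simp: atLeast0LessThan intro!: mult_in_R sigma_pow_in_R)
  moreover have "map (\<lambda>i. shifted_lc ord ?\<delta> (g i)) [0..<k] = map (shifted_lc ord ?\<delta>) (map g [0..<k])"
    by simp
  moreover have "set (map g [0..<k]) \<subseteq> G (\<phi> k)"
    using G[of "\<phi> k"] strict_monoD[OF \<phi>] by (auto simp: g_def)
  moreover have "\<forall>h\<in>set (map g [0..<k]). lexp ord h \<le> ?\<delta>"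
    using div by auto
  ultimately have "reducible ord (left_solution R) (G (\<phi> k)) (g k)"
    unfolding reducible_def reduces_def using g(1) by metis
  then show False using irr by (simp add: g_def)
qed

definition irreducible_extension :: "('a set \<times> 'a set) set" where
  "irreducible_extension = {(insert f G, G) | f G. f \<noteq> 0 \<and> \<not> reducible ord (left_solution R) G f}"

lemma wf_irreducible_extension:
  assumes "left_noetherian R"
  shows "wf irreducible_extension"
  unfolding wf_iff_no_infinite_down_chain
proof
  assume "\<exists>G. \<forall>i. (G (Suc i), G i) \<in> irreducible_extension"
  then obtain G where "\<And>i. (G (Suc i), G i) \<in> irreducible_extension" by blast
  then have "\<forall>i. \<exists>f. G (Suc i) = insert f (G i) \<and> f \<noteq> 0 \<and> \<not> reducible ord (left_solution R) (G i) f"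
    unfolding irreducible_extension_def by blast
  then obtain r where r: "\<And>i. G (Suc i) = insert (r i) (G i)" "\<And>i. r i \<noteq> 0"
    "\<And>i. \<not> reducible ord (left_solution R) (G i) (r i)" by metis
  have initial: "r ` {..<k} \<subseteq> G k" for k
    by (induction k) (auto simp: r(1) lessThan_Suc)
  obtain k where "\<forall>G. r ` {..<k} \<subseteq> G \<longrightarrow> r k \<noteq> 0 \<longrightarrow> reducible ord (left_solution R) G (r k)"
    using no_irreducible_sequence[OF assms, of r] by (elim exE)
  then have "reducible ord (left_solution R) (G k) (r k)" using initial r(2) by simp
  then show False using r(3) by simp
qed

end

section \<open>Reduction steps and combinations of generators\<close>

context ordered_skew_pbw
begin

lemma shifted_sum_solution:
  assumes "left_solution R a (map (shifted_lc ord \<delta>) gs) bs" "\<delta> \<in> exponents n"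
    and "\<And>g. g \<in> set gs \<Longrightarrow> g \<noteq> 0 \<and> lexp ord g \<le> \<delta>"
  shows "shifted_sum ord \<delta> bs gs \<in> supported (below_eq \<delta>)"
    and "coefficient (shifted_sum ord \<delta> bs gs) \<delta> = a"
    and "finite G \<Longrightarrow> set gs \<subseteq> G \<Longrightarrow> shifted_sum ord \<delta> bs gs \<in> rep G (below_eq \<delta>)"
proof -
  let ?c = "\<lambda>j. cofactor ord \<delta> (gs ! j)"
  have len: "length bs = length gs"
    and a: "a = (\<Sum>j<length gs. bs ! j * shifted_lc ord \<delta> (gs ! j))"
    using assms(1) by (auto simp: left_solution_def sum_list_zip_nth)
  have bs: "bs ! j \<in> R" if "j < length gs" for j
    using assms(1) that len nth_mem[of j bs] by (auto simp: left_solution_def)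
  have s: "shifted_sum ord \<delta> bs gs = (\<Sum>j<length gs. bs ! j * (mon (?c j) * gs ! j))"
    by (simp add: shifted_sum_def sum_list_zip_nth len mult.assoc)
  show "shifted_sum ord \<delta> bs gs \<in> supported (below_eq \<delta>)"
    unfolding s using assms(2,3) bs by (intro supported_sum supported_mult shifted_product) auto
  show "coefficient (shifted_sum ord \<delta> bs gs) \<delta> = a"
    unfolding s a coefficient_sum
    by (rule sum.cong) (use assms(2,3) bs in \<open>auto simp: coefficient_mult shifted_product\<close>)
  assume G: "finite G" "set gs \<subseteq> G"
  have "mon (?c j) * gs ! j \<in> rep G (below_eq \<delta>)" if "j < length gs" for j
  proof (rule rep_single)
    show "mon (?c j) \<in> supported {\<alpha>. \<alpha> + lexp ord (gs ! j) \<in> below_eq \<delta>}"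
      using assms(2,3) that by (intro supported_monomial cofactor_exponents) (auto simp: cofactor_add)
  qed (use G that nth_mem in auto)
  then show "shifted_sum ord \<delta> bs gs \<in> rep G (below_eq \<delta>)"
    unfolding s using bs by (intro rep_sum rep_scale[of "bs ! _"]) auto
qed

text \<open>
  A reduction step trades \<open>f\<close> for an element strictly below, at the cost of terms that do not exceed
  the leading exponent of \<open>f\<close>. The first fact yields representations, the second one termination.
\<close>

lemma reduction_step:
  assumes "left_solution R (lc ord f) (map (shifted_lc ord (lexp ord f)) fs) rs"
    and "f \<noteq> 0" "finite G" "0 \<notin> G" "set fs \<subseteq> G" "\<And>g. g \<in> set fs \<Longrightarrow> lexp ord g \<le> lexp ord f"
  shows "shifted_sum ord (lexp ord f) rs fs \<in> rep G (below_eq (lexp ord f))"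
    and "f - shifted_sum ord (lexp ord f) rs fs \<in> supported (below (lexp ord f))"
proof -
  let ?\<delta> = "lexp ord f" and ?s = "shifted_sum ord (lexp ord f) rs fs"
  have "\<And>g. g \<in> set fs \<Longrightarrow> g \<noteq> 0 \<and> lexp ord g \<le> ?\<delta>" using assms by auto
  note s = shifted_sum_solution[OF assms(1) lexp_exponents[OF assms(2)] this]
  show "?s \<in> rep G (below_eq ?\<delta>)" using s(3) assms by simp
  have "f - ?s \<in> supported (below_eq ?\<delta>)"
    by (rule supported_diff[OF lexp_top(2)[OF assms(2)]]) (rule s(1))
  moreover have "coefficient (f - ?s) ?\<delta> = 0"
    using s(2) by (simp add: coefficient_diff lc_def)
  ultimately show "f - ?s \<in> supported (below ?\<delta>)"
    by (rule supported_remove)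
qed

lemma syzygies_reduce_mono:
  "syzygies_reduce G S \<Longrightarrow> G \<subseteq> H \<Longrightarrow> finite H \<Longrightarrow> syzygies_reduce H S"
  unfolding syzygies_reduce_def using rep_mono_generators by blast

end


section \<open>Runs of the algorithm\<close>

text \<open>
  The algorithm with arbitrary choices and the one with given subroutines are both covered by
  assuming only that \<open>sol\<close> returns solutions, and some solution whenever one exists, and that \<open>gens\<close>
  returns generating sets.
\<close>

locale buchberger_run = ordered_skew_pbw +
  fixes sol :: "'a \<Rightarrow> 'a list \<Rightarrow> 'a list \<Rightarrow> bool" and gens :: "'a list \<Rightarrow> 'a list set \<Rightarrow> bool"
    and F :: "'a set"
  assumes noetherian: "left_noetherian R"
    and sol_sound: "a \<in> R \<Longrightarrow> cs \<in> lists R \<Longrightarrow> sol a cs rs \<Longrightarrow> left_solution R a cs rs"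
    and sol_complete: "a \<in> R \<Longrightarrow> cs \<in> lists R \<Longrightarrow> left_solution R a cs rs \<Longrightarrow> \<exists>rs. sol a cs rs"
    and gens_sound: "cs \<in> lists R \<Longrightarrow> gens cs B \<Longrightarrow> generates_Syz R cs B"
    and gens_exist: "cs \<in> lists R \<Longrightarrow> \<exists>B. gens cs B"
    and F: "finite F" "F \<noteq> {}" "0 \<notin> F"
begin

abbreviation I :: "'a set" where
  "I \<equiv> left_ideal UNIV hull F"

abbreviation step :: "'a state \<Rightarrow> 'a state \<Rightarrow> bool" where
  "step \<equiv> buchberger_step ord sol gens"

lemma shifted_lcs_in_R: "0 \<notin> set gs \<Longrightarrow> \<delta> \<in> exponents n \<Longrightarrow> map (shifted_lc ord \<delta>) gs \<in> lists R"
  by (force simp: intro: shifted_lc_in_R)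

text \<open>
  An element that the computed \<open>sol\<close> cannot reduce is irreducible without restriction. The next two
  facts thus carry everything over from \<open>left_solution R\<close> to \<open>sol\<close>.
\<close>

lemma reducible_sol:
  assumes "reducible ord (left_solution R) G f" "0 \<notin> G"
  shows "reducible ord sol G f"
proof -
  obtain fs rs where f: "f \<noteq> 0" "set fs \<subseteq> G" "\<forall>g\<in>set fs. lexp ord g \<le> lexp ord f"
    "left_solution R (lc ord f) (map (shifted_lc ord (lexp ord f)) fs) rs"
    using assms(1) unfolding reducible_def reduces_def by blast
  have "map (shifted_lc ord (lexp ord f)) fs \<in> lists R"
    using f assms(2) by (intro shifted_lcs_in_R lexp_exponents) auto
  then show ?thesis
    using sol_complete[OF lc_in_R _ f(4)] f unfolding reducible_def reduces_def by blast
qed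

lemma reduces_sol:
  assumes "reduces ord sol G f h" "f \<noteq> 0" "finite G" "0 \<notin> G"
  shows "f - h \<in> rep G (below_eq (lexp ord f))" "h \<in> supported (below (lexp ord f))"
proof -
  obtain fs rs where f: "set fs \<subseteq> G" "\<forall>g\<in>set fs. lexp ord g \<le> lexp ord f"
    "sol (lc ord f) (map (shifted_lc ord (lexp ord f)) fs) rs"
    and h: "h = f - shifted_sum ord (lexp ord f) rs fs"
    using assms(1,2) unfolding reduces_def by blast
  have "map (shifted_lc ord (lexp ord f)) fs \<in> lists R"
    using f(1) assms by (intro shifted_lcs_in_R lexp_exponents) auto
  from sol_sound[OF lc_in_R this f(3)] f(1,2) assms(2-4)
  show "f - h \<in> rep G (below_eq (lexp ord f))" "h \<in> supported (below (lexp ord f))"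
    unfolding h using reduction_step[of f fs rs G] by auto
qed

definition admissible :: "'a set \<Rightarrow> 'a set \<Rightarrow> bool" where
  "admissible G G' \<longleftrightarrow> finite G' \<and> G \<subseteq> G' \<and> F \<subseteq> G' \<and> G' \<subseteq> I - {0}"

lemma admissible_simps:
  assumes "admissible G G'"
  shows "finite G'" "finite G" "0 \<notin> G'" "G \<subseteq> G'"
  using assms finite_subset by (auto simp: admissible_def)

lemma rep_eq_ideal:
  assumes "admissible G G'"
  shows "rep G' UNIV = I"
proof
  have "I = rep F UNIV" using hull_eq_rep F(1) by blast
  then show "I \<subseteq> rep G' UNIV"
    using rep_mono_generators[of _ F UNIV G'] assms by (auto simp: admissible_def)
  show "rep G' UNIV \<subseteq> I"
  proof
    fix f assume "f \<in> rep G' UNIV"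
    then show "f \<in> I"
    proof (rule repE)
      fix a assume f: "f = (\<Sum>g\<in>G'. a g * g)"
      have "a g * g \<in> I" if "g \<in> G'" for g
        using left_ideal_hull[of F] assms that by (auto simp: left_ideal_def admissible_def)
      then show "f \<in> I"
        unfolding f by (rule left_ideal_sum[OF left_ideal_hull])
    qed
  qed
qed

lemma admissible_insert:
  "admissible G G' \<Longrightarrow> f \<in> I \<Longrightarrow> f \<noteq> 0 \<Longrightarrow> admissible G (insert f G')"
  by (auto simp: admissible_def)

definition processed :: "'a set \<Rightarrow> 'a list \<Rightarrow> 'a list \<Rightarrow> bool" where
  "processed G' gs b \<longleftrightarrow>
     shifted_sum ord (lcm_exp ord (set gs)) b gs \<in> rep G' (below (lcm_exp ord (set gs)))"

text \<open>
  The loop invariant. In the inner loops, \<open>B\<^sub>0\<close> is the set of syzygies of which \<open>B\<close> still remains,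
  and in \<open>Reduce\<close> the syzygy \<open>b\<close> is the current one. Its combination differs from \<open>f\<close> by a
  combination of \<open>G'\<close> with leading exponents below the least common multiple.
\<close>

fun invariant :: "'a state \<Rightarrow> bool" where
  "invariant (Test G G') \<longleftrightarrow> admissible G G' \<and> (\<forall>S\<subseteq>G. S \<noteq> {} \<longrightarrow> syzygies_reduce G' S)"
| "invariant (For_S G G' D) \<longleftrightarrow> admissible G G' \<and> D \<subseteq> Pow G - {{}} \<and>
     (\<forall>S\<subseteq>G. S \<noteq> {} \<longrightarrow> S \<notin> D \<longrightarrow> syzygies_reduce G' S)"
| "invariant (For_B G G' D gs B) \<longleftrightarrow> admissible G G' \<and> D \<subseteq> Pow G - {{}} \<and>
     set gs \<subseteq> G \<and> gs \<noteq> [] \<and> distinct gs \<and>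
     (\<forall>S\<subseteq>G. S \<noteq> {} \<longrightarrow> S \<notin> D \<longrightarrow> S \<noteq> set gs \<longrightarrow> syzygies_reduce G' S) \<and>
     (\<exists>B\<^sub>0. generates_Syz R (map (shifted_lc ord (lcm_exp ord (set gs))) gs) B\<^sub>0 \<and> B \<subseteq> B\<^sub>0 \<and>
        (\<forall>b\<in>B\<^sub>0 - B. processed G' gs b))"
| "invariant (Reduce G G' D gs B f) \<longleftrightarrow> admissible G G' \<and> D \<subseteq> Pow G - {{}} \<and>
     set gs \<subseteq> G \<and> gs \<noteq> [] \<and> distinct gs \<and>
     (\<forall>S\<subseteq>G. S \<noteq> {} \<longrightarrow> S \<notin> D \<longrightarrow> S \<noteq> set gs \<longrightarrow> syzygies_reduce G' S) \<and>
     (\<exists>B\<^sub>0 b. generates_Syz R (map (shifted_lc ord (lcm_exp ord (set gs))) gs) B\<^sub>0 \<and> B \<subseteq> B\<^sub>0 \<and>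
        (\<forall>b'\<in>B\<^sub>0 - insert b B. processed G' gs b') \<and>
        shifted_sum ord (lcm_exp ord (set gs)) b gs - f \<in> rep G' (below (lcm_exp ord (set gs)))) \<and>
     f \<in> supported (below (lcm_exp ord (set gs))) \<and> f \<in> I"
| "invariant (Output G) \<longleftrightarrow> groebner_basis ord I G"

lemma lcm_facts:
  assumes "admissible G G'" "set gs \<subseteq> G" "gs \<noteq> []"
  shows "lcm_exp ord (set gs) \<in> exponents n"
    and "\<And>g. g \<in> set gs \<Longrightarrow> g \<noteq> 0 \<and> lexp ord g \<le> lcm_exp ord (set gs)"
    and "map (shifted_lc ord (lcm_exp ord (set gs))) gs \<in> lists R"
proof -
  have 0: "0 \<notin> set gs" using assms admissible_simps[OF assms(1)] by blast
  then show X: "lcm_exp ord (set gs) \<in> exponents n"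
    using assms(3) by (intro lcm_exp_exponents) auto
  show "\<And>g. g \<in> set gs \<Longrightarrow> g \<noteq> 0 \<and> lexp ord g \<le> lcm_exp ord (set gs)"
    using 0 lcm_exp_upper[of "set gs"] by auto
  show "map (shifted_lc ord (lcm_exp ord (set gs))) gs \<in> lists R"
    by (rule shifted_lcs_in_R[OF 0 X])
qed

lemma output_is_groebner_basis:
  assumes "admissible G G" "\<forall>S\<subseteq>G. S \<noteq> {} \<longrightarrow> syzygies_reduce G S"
  shows "groebner_basis ord I G"
proof -
  obtain f where "f \<in> F" using F(2) by blast
  then have "f \<in> I" "f \<noteq> 0" using F(3) hull_inc[of f F] by auto
  then have "I \<noteq> {0}" by blast
  moreover have "reducible ord (left_solution R) G f" if "f \<in> I - {0}" for f
    using that assms admissible_simps[OF assms(1)] rep_eq_ideal[OF assms(1)]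
    by (intro buchberger_criterion) auto
  moreover have "G \<noteq> {}" "finite G" "G \<subseteq> I - {0}"
    using assms(1) F(2) by (auto simp: admissible_def)
  ultimately show ?thesis by (simp add: groebner_basis_def)
qed

text \<open>
  A syzygy of the coefficients at the least common multiple makes the leading terms cancel, so the
  reduction starts strictly below it and stays there.
\<close>

lemma combination_start:
  assumes "admissible G G'" "set gs \<subseteq> G" "gs \<noteq> []"
    and "generates_Syz R (map (shifted_lc ord (lcm_exp ord (set gs))) gs) B" "b \<in> B"
  shows "shifted_sum ord (lcm_exp ord (set gs)) b gs \<in> supported (below (lcm_exp ord (set gs)))"
    and "shifted_sum ord (lcm_exp ord (set gs)) b gs \<in> I"
proof -
  let ?X = "lcm_exp ord (set gs)"
  have "left_solution R 0 (map (shifted_lc ord ?X) gs) b"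
    using assms(4,5) by (auto simp: generates_Syz_def Syz_def)
  note s = shifted_sum_solution[OF this lcm_facts(1)[OF assms(1-3)] lcm_facts(2)[OF assms(1-3)]]
  show "shifted_sum ord ?X b gs \<in> supported (below ?X)"
    using s(1,2) by (rule supported_remove)
  have "shifted_sum ord ?X b gs \<in> rep G' UNIV"
    using rep_mono_exponents[OF s(3)[of G']] assms(2) admissible_simps[OF assms(1)] by blast
  then show "shifted_sum ord ?X b gs \<in> I"
    using rep_eq_ideal[OF assms(1)] by simp
qed

lemma invariant_step:
  assumes "step s t" "invariant s"
  shows "invariant t"
  using assms
proof (induction rule: buchberger_step.induct)
  case (enter G' G)
  then show ?case by (auto simp: admissible_def)
next
  case (stop G' G)
  then show ?case using output_is_groebner_basis by simp
next
  case (next_S S D gs B G G')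
  then have adm: "admissible G G'" and gs: "set gs \<subseteq> G" "gs \<noteq> []" by auto
  have "generates_Syz R (map (shifted_lc ord (lcm_exp ord (set gs))) gs) B"
    using gens_sound[OF lcm_facts(3)[OF adm gs]] next_S by simp
  then have "\<exists>B\<^sub>0. generates_Syz R (map (shifted_lc ord (lcm_exp ord (set gs))) gs) B\<^sub>0 \<and> B \<subseteq> B\<^sub>0 \<and>
      (\<forall>b\<in>B\<^sub>0 - B. processed G' gs b)" by auto
  then show ?case
    using next_S adm gs by auto
next
  case (done_S G G')
  then show ?case by simp
next
  case (next_b b B G G' D gs)
  then obtain B\<^sub>0 where B\<^sub>0: "generates_Syz R (map (shifted_lc ord (lcm_exp ord (set gs))) gs) B\<^sub>0"
    "B \<subseteq> B\<^sub>0" "\<forall>b\<in>B\<^sub>0 - B. processed G' gs b" by auto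
  have "b \<in> B\<^sub>0" using next_b B\<^sub>0 by blast
  have eq: "insert b (B - {b}) = B" using next_b by blast
  have "\<exists>B\<^sub>0 b'. generates_Syz R (map (shifted_lc ord (lcm_exp ord (set gs))) gs) B\<^sub>0 \<and> B - {b} \<subseteq> B\<^sub>0 \<and>
        (\<forall>b''\<in>B\<^sub>0 - insert b' (B - {b}). processed G' gs b'') \<and>
        shifted_sum ord (lcm_exp ord (set gs)) b' gs - shifted_sum ord (lcm_exp ord (set gs)) b gs
          \<in> rep G' (below (lcm_exp ord (set gs)))"
    using B\<^sub>0 rep_zero eq by (intro exI[of _ B\<^sub>0] exI[of _ b]) auto
  then show ?case
    using next_b combination_start[of G G' gs B\<^sub>0 b] B\<^sub>0(1) \<open>b \<in> B\<^sub>0\<close> by simp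
next
  case (done_b G G' D gs)
  then have "syzygies_reduce G' (set gs)"
    unfolding syzygies_reduce_def by (auto simp: processed_def)
  then show ?case using done_b by auto
next
  case (reduce f G' h G D gs B)
  let ?X = "lcm_exp ord (set gs)"
  have adm: "admissible G G'" using reduce by simp
  note red = reduces_sol[OF reduce(2,1) admissible_simps(1,3)[OF adm]]
  have X: "lexp ord f \<in> below ?X"
    using reduce by (auto intro: lexp_supported)
  have diff: "f - h \<in> rep G' (below ?X)"
    by (rule rep_mono_exponents[OF red(1) below_eq_below[OF X]])
  have "h \<in> supported (below ?X)"
    by (rule supported_mono[OF red(2)]) (use below_eq_below[OF X] in auto)
  moreover have "h \<in> I"
  proof -
    have "f - h \<in> rep G' UNIV" "f \<in> rep G' UNIV"
      using rep_mono_exponents[OF diff] reduce rep_eq_ideal[OF adm] by auto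
    then have "f - (f - h) \<in> rep G' UNIV" using rep_diff[of f G' UNIV "f - h"] by blast
    then show ?thesis using rep_eq_ideal[OF adm] by simp
  qed
  moreover obtain B\<^sub>0 b where b: "generates_Syz R (map (shifted_lc ord ?X) gs) B\<^sub>0" "B \<subseteq> B\<^sub>0"
    "\<forall>b'\<in>B\<^sub>0 - insert b B. processed G' gs b'" "shifted_sum ord ?X b gs - f \<in> rep G' (below ?X)"
    using reduce by auto
  moreover have "shifted_sum ord ?X b gs - h \<in> rep G' (below ?X)"
    using rep_add[OF b(4) diff] by simp
  ultimately show ?case using reduce(3) by auto
next
  case (reduced_nonzero f G' G D gs B)
  let ?X = "lcm_exp ord (set gs)" and ?H = "insert f G'"
  have adm: "admissible G G'" and fI: "f \<in> I" "f \<in> supported (below ?X)" using reduced_nonzero by auto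
  have H: "admissible G ?H" using adm fI reduced_nonzero(1) by (intro admissible_insert)
  have fin: "finite ?H" using admissible_simps[OF H] by simp
  obtain B\<^sub>0 b where b: "generates_Syz R (map (shifted_lc ord ?X) gs) B\<^sub>0" "B \<subseteq> B\<^sub>0"
    "\<forall>b'\<in>B\<^sub>0 - insert b B. processed G' gs b'" "shifted_sum ord ?X b gs - f \<in> rep G' (below ?X)"
    using reduced_nonzero by auto
  (* the remainder has become a generator, so that 1 * f is a representation of it *)
  have "1 * f \<in> rep ?H (below ?X)"
  proof (rule rep_single[OF fin])
    have "lexp ord f \<in> below ?X" using fI reduced_nonzero(1) by (intro lexp_supported)
    then show "1 \<in> supported {\<alpha>. \<alpha> + lexp ord f \<in> below ?X}"
      using supported_monomial[of 0 "{\<alpha>. \<alpha> + lexp ord f \<in> below ?X}"] by simp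
  qed simp
  moreover have "shifted_sum ord ?X b gs - f \<in> rep ?H (below ?X)"
    by (rule rep_mono_generators[OF b(4) _ fin]) auto
  ultimately have "processed ?H gs b"
    using rep_add[of "shifted_sum ord ?X b gs - f" ?H "below ?X" f] by (simp add: processed_def)
  moreover have "processed ?H gs b'" if "processed G' gs b'" for b'
    using that rep_mono_generators[OF _ _ fin] unfolding processed_def by blast
  ultimately have "\<forall>b'\<in>B\<^sub>0 - B. processed ?H gs b'" using b(3) by blast
  moreover have "syzygies_reduce ?H S" if "syzygies_reduce G' S" for S
    using syzygies_reduce_mono[OF that _ fin] by blast
  ultimately show ?case using reduced_nonzero(3) b(1,2) H by auto
next
  case (reduced_zero G G' D gs B)
  then obtain B\<^sub>0 b where b: "generates_Syz R (map (shifted_lc ord (lcm_exp ord (set gs))) gs) B\<^sub>0" "B \<subseteq> B\<^sub>0"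
    "\<forall>b'\<in>B\<^sub>0 - insert b B. processed G' gs b'"
    "shifted_sum ord (lcm_exp ord (set gs)) b gs - 0 \<in> rep G' (below (lcm_exp ord (set gs)))"
    by auto
  then have "processed G' gs b" by (simp add: processed_def)
  then have "\<forall>b'\<in>B\<^sub>0 - B. processed G' gs b'" using b(3) by blast
  then show ?case using reduced_zero b(1,2) by auto
qed

lemma invariant_start: "invariant (Test {} F)"
  using F hull_subset[of F] by (auto simp: admissible_def)

lemma invariant_progress:
  assumes "invariant s" "\<not> (\<exists>t. step s t)"
  shows "\<exists>G. s = Output G"
proof (cases s)
  case (Test G G')
  then show ?thesis using assms(2) buchberger_step.enter buchberger_step.stop by metis
next
  case (For_S G G' D)
  show ?thesis
  proof (cases "D = {}")
    case True
    then show ?thesis using assms(2) For_S buchberger_step.done_S by metis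
  next
    case False
    then obtain S where S: "S \<in> D" by blast
    have invariant: "admissible G G'" "D \<subseteq> Pow G - {{}}" using assms(1) For_S by auto
    then have "S \<subseteq> G" "S \<noteq> {}" using S by auto
    then obtain gs where gs: "set gs = S" "distinct gs"
      using finite_distinct_list[of S] admissible_simps[OF invariant(1)] finite_subset by blast
    then have "set gs \<subseteq> G" "gs \<noteq> []" using \<open>S \<subseteq> G\<close> \<open>S \<noteq> {}\<close> by auto
    then obtain B where "gens (map (shifted_lc ord (lcm_exp ord S)) gs) B"
      using gens_exist[OF lcm_facts(3)[OF invariant(1)]] gs(1) by blast
    then show ?thesis using assms(2) For_S buchberger_step.next_S[OF S gs] by blast
  qed
next
  case (For_B G G' D gs B)
  then show ?thesis
    using assms(2) buchberger_step.next_b buchberger_step.done_b by (metis all_not_in_conv)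
next
  case (Reduce G G' D gs B f)
  then show ?thesis
    using assms(2) buchberger_step.reduce buchberger_step.reduced_nonzero buchberger_step.reduced_zero
    unfolding reducible_def by metis
qed simp

text \<open>
  The first component changes only when a new element is found. The second one orders the phases
  of the outer loop by whether the current pass has already found a new element, in which case one
  more pass follows. The others count what remains to be done in the inner loops, where a
  polynomial is measured by the position of its leading monomial in the order.
\<close>

fun meas :: "'a state \<Rightarrow> 'a set \<times> nat \<times> nat \<times> nat \<times> nat" where
  "meas (Test G G') = (G', if G = G' then 1 else 3, 0, 0, 0)"
| "meas (For_S G G' D) = (G', if G = G' then 2 else 4, 2 * card D, 0, 0)"
| "meas (For_B G G' D gs B) = (G', if G = G' then 2 else 4, 2 * card D + 1, 2 * card B, 0)"
| "meas (Reduce G G' D gs B f) = (G', if G = G' then 2 else 4, 2 * card D + 1, 2 * card B + 1,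
     if f = 0 then 0 else Suc (card (below (lexp ord f))))"
| "meas (Output G) = (G, 0, 0, 0, 0)"

lemma step_decreases:
  assumes "step s t" "invariant s"
  shows "(meas t, meas s) \<in> irreducible_extension <*lex*> less_than <*lex*> less_than <*lex*> less_than <*lex*> less_than"
  using assms
proof (induction rule: buchberger_step.induct)
  case (next_S S D gs B G G')
  then have "finite G" "D \<subseteq> Pow G" using admissible_simps(2)[of G G'] by auto
  then have "finite D" using finite_subset by blast
  then have "card (D - {S}) < card D" using next_S by (intro card_Diff1_less)
  then show ?case by auto
next
  case (next_b b B G G' D gs)
  then have "finite B" by (auto simp: generates_Syz_def intro: finite_subset)
  then have "card (B - {b}) < card B" using next_b by (intro card_Diff1_less)
  then show ?case by auto
next
  case (reduce f G' h G D gs B)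
  have adm: "admissible G G'" using reduce by simp
  have "h \<in> supported (below (lexp ord f))"
    by (rule reduces_sol(2)[OF reduce(2,1) admissible_simps(1,3)[OF adm]])
  then have "h = 0 \<or> card (below (lexp ord h)) < card (below (lexp ord f))"
    using lexp_supported card_below_less by blast
  then show ?case using reduce(1) by auto
next
  case (reduced_nonzero f G' G D gs B)
  then have "\<not> reducible ord (left_solution R) G' f"
    using reducible_sol admissible_simps(3)[of G G'] by auto
  then have "(insert f G', G') \<in> irreducible_extension"
    using reduced_nonzero(1) by (auto simp: irreducible_extension_def)
  then show ?case by simp
qed auto

lemma algorithm_correct: "always_produces step (Test {} F) (groebner_basis ord I)"
proof -
  have "\<not> (run 0 = Test {} F \<and> (\<forall>k. step (run k) (run (Suc k))))" for run
  proof
    assume run: "run 0 = Test {} F \<and> (\<forall>k. step (run k) (run (Suc k)))"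
    have "invariant (run k)" for k
      by (induction k) (use run invariant_start invariant_step in auto)
    then have "(meas (run (Suc k)), meas (run k)) \<in>
        irreducible_extension <*lex*> less_than <*lex*> less_than <*lex*> less_than <*lex*> less_than" for k
      using run step_decreases by blast
    moreover have "wf (irreducible_extension <*lex*> less_than <*lex*> less_than <*lex*> less_than <*lex*> less_than)"
      by (intro wf_lex_prod wf_less_than wf_irreducible_extension noetherian)
    ultimately show False
      unfolding wf_iff_no_infinite_down_chain by (elim notE) (rule exI[of _ "\<lambda>k. meas (run k)"], simp)
  qed
  moreover have "\<exists>G. t = Output G \<and> groebner_basis ord I G"
    if "step\<^sup>*\<^sup>* (Test {} F) t" "\<not> (\<exists>u. step t u)" for t
  proof -
    have "invariant t"
      using that(1) by (induction rule: rtranclp_induct) (use invariant_start invariant_step in auto)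
    then show ?thesis using invariant_progress[OF _ that(2)] by force
  qed
  ultimately show ?thesis unfolding always_produces_def by blast
qed

end

theorem corollary102:
  fixes R :: "'a::ring_1 set" and n :: nat and x :: "nat \<Rightarrow> 'a"
    and ord :: "(nat \<Rightarrow> nat) rel"
    and solve :: "'a \<Rightarrow> 'a list \<Rightarrow> 'a list option" and syz :: "'a list \<Rightarrow> 'a list set"
    and F :: "'a set"
  assumes "bijective_skew_pbw R n x"
    and "lgs_ring R solve syz"
    and "skew_pbw.monomial_order R n x ord"
    and "finite F" and "F \<noteq> {}" and "0 \<notin> F"
  shows
    "always_produces
       (skew_pbw.buchberger_step R n x ord (left_solution R) (generates_Syz R))
       (Test {} F)
       (skew_pbw.groebner_basis R n x ord (left_ideal UNIV hull F)) \<and>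
     always_produces
       (skew_pbw.buchberger_step R n x ord (\<lambda>a cs rs. solve a cs = Some rs) (\<lambda>cs B. B = syz cs))
       (Test {} F)
       (skew_pbw.groebner_basis R n x ord (left_ideal UNIV hull F))"
proof -
  interpret bijective_skew_pbw R n x by (rule assms(1))
  interpret ordered_skew_pbw R n x ord by unfold_locales (rule assms(3))
  have noetherian: "left_noetherian R"
    and syz: "\<And>cs. cs \<in> lists R \<Longrightarrow> generates_Syz R cs (syz cs)"
    using assms(2) by (auto simp: lgs_ring_def)
  have solve: "case solve a cs of None \<Rightarrow> \<not> (\<exists>rs. left_solution R a cs rs) | Some rs \<Rightarrow> left_solution R a cs rs"
    if "a \<in> R" "cs \<in> lists R" for a cs
    using assms(2) that unfolding lgs_ring_def by blast
  interpret any: buchberger_run R n x ord "left_solution R" "generates_Syz R" F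
    by unfold_locales (use noetherian syz assms in auto)
  interpret computed: buchberger_run R n x ord "\<lambda>a cs rs. solve a cs = Some rs" "\<lambda>cs B. B = syz cs" F
  proof unfold_locales
    show "left_solution R a cs rs" if "a \<in> R" "cs \<in> lists R" "solve a cs = Some rs" for a cs rs
      using solve[OF that(1,2)] that(3) by simp
    show "\<exists>rs. solve a cs = Some rs" if "a \<in> R" "cs \<in> lists R" "left_solution R a cs rs" for a cs rs
      using solve[OF that(1,2)] that(3) by (auto split: option.splits)
  qed (use noetherian syz assms in auto)
  show ?thesis
    using any.algorithm_correct computed.algorithm_correct by blast
qed

end
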